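(* The Riemannian distance of the metric $g^\Delta$ on $\Omega$ is $$d_\Delta(x,y)=\bigl\|\mathrm{Log}_\Delta(x)-\mathrm{Log}_\Delta(y)\bigr\|_\Delta,\qquad x,y\in\Omega.$$ Moreover, $(\Omega,g^\Delta)$ is complete, and the Levi-Civita connection of $g^\Delta$ is the flat torsion-free connection $\nabla^\Delta$.
   Context: Let $V\subset \mathrm{Sym}(3,\mathbb{R})$ be the 5-dimensional space of real symmetric $3\times3$ matrices whose $(1,2)$ and $(2,1)$ entries are $0$, and let $\Omega\subset V$ be the open cone of positive definite matrices in $V$. Each $x\in\Omega$ has a unique lower triangular Cholesky factor $T_x$ with positive diagonal and $x=T_xT_x^{\top}$ (its $(2,1)$ entry vanishes). For $v\in V$ let $\underline{v}$ be the unique lower triangular matrix with $v=\underline v+\underline v^{\top}$. The clan product on $V$ is $u\Delta w=\underline u\,w+w\,\underline u^{\top}$, $L_u(w)=u\Delta w$, and $Q_\Delta(u,v)=\mathrm{tr}(L_{u\Delta v})$, which is a (positive definite) inner product on $V$; $\|u\|_\Delta=Q_\Delta(u,u)^{1/2}$. The clan exponential $\mathrm{Exp}_\Delta:V\to\Omega$, $\mathrm{Exp}_\Delta(v)=\exp(\underline v)\exp(\underline v)^{\top}$, is a diffeomorphism with inverse $\mathrm{Log}_\Delta(x)=\log(T_x)+\log(T_x)^{\top}$ (principal logarithm). The metric $g^\Delta$ is $g^\Delta_x(u,v)=Q_\Delta\bigl((d\mathrm{Log}_\Delta)_xu,(d\mathrm{Log}_\Delta)_xv\bigr)$. With $D^V$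 the standard flat connection on the vector space $V$, the connection $\nabla^\Delta$ on $\Omega$ is $\nabla^\Delta_UW:=(\mathrm{Exp}_\Delta)_*\bigl(D^V_{(\mathrm{Log}_\Delta)_*U}(\mathrm{Log}_\Delta)_*W\bigr)$. *)

theory Defs
  imports "HOL-Analysis.Analysis"
begin

section \<open>The vector space \<open>V\<close>\<close>

text \<open>\<open>V\<close> is made a type of its own, so that \<open>\<Omega>\<close> is an open set in the
  sense of its topology and ordinary Frechet derivatives apply.  The inner product below is the
  Frobenius one; it only supplies the vector space topology and an orthonormal basis for the
  trace of a linear operator.\<close>

typedef V = "{v :: real^3^3. transpose v = v \<and> v $ 1 $ 2 = 0 \<and> v $ 2 $ 1 = 0}"
  morphisms matrix_of V_of
  by (rule exI[of _ 0]) (simp add: transpose_def vec_eq_iff)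

setup_lifting type_definition_V

instantiation V :: real_inner
begin

lift_definition zero_V :: V is 0 by (simp add: transpose_def vec_eq_iff)
lift_definition plus_V :: "V \<Rightarrow> V \<Rightarrow> V" is "(+)" by (simp add: transpose_def vec_eq_iff)
lift_definition minus_V :: "V \<Rightarrow> V \<Rightarrow> V" is "(-)" by (simp add: transpose_def vec_eq_iff)
lift_definition uminus_V :: "V \<Rightarrow> V" is "uminus" by (simp add: transpose_def vec_eq_iff)
lift_definition scaleR_V :: "real \<Rightarrow> V \<Rightarrow> V" is "(*\<^sub>R)" by (simp add: transpose_def vec_eq_iff)
lift_definition inner_V :: "V \<Rightarrow> V \<Rightarrow> real" is "(\<bullet>)" .
lift_definition norm_V :: "V \<Rightarrow> real" is norm .
lift_definition dist_V :: "V \<Rightarrow> V \<Rightarrow> real" is dist .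
lift_definition sgn_V :: "V \<Rightarrow> V" is sgn by (simp add: sgn_div_norm transpose_def vec_eq_iff)

definition uniformity_V :: "(V \<times> V) filter" where
  "uniformity_V = (INF e\<in>{0 <..}. principal {(x, y). dist x y < e})"

definition open_V :: "V set \<Rightarrow> bool" where
  "open_V U \<longleftrightarrow> (\<forall>x\<in>U. eventually (\<lambda>(x', y). x' = x \<longrightarrow> y \<in> U) uniformity)"

instance
proof
  fix U :: "V set"
  show "open U \<longleftrightarrow> (\<forall>x\<in>U. eventually (\<lambda>(x', y). x' = x \<longrightarrow> y \<in> U) uniformity)"
    by (rule open_V_def)
  show "(uniformity :: (V \<times> V) filter) = (INF e\<in>{0 <..}. principal {(x, y). dist x y < e})"
    by (rule uniformity_V_def)
qed (transfer; simp add: dist_norm sgn_div_norm norm_eq_sqrt_inner algebra_simps inner_commute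
      inner_add_left)+

end

definition V_coords :: "real \<Rightarrow> real \<Rightarrow> real \<Rightarrow> real \<Rightarrow> real \<Rightarrow> V" where
  "V_coords a b c p q = V_of (vector [vector [a, 0, p], vector [0, b, q], vector [p, q, c]])"

lemma inner_V_coords:
  "x \<bullet> V_coords a b c p q =
     a * matrix_of x $ 1 $ 1 + b * matrix_of x $ 2 $ 2 + c * matrix_of x $ 3 $ 3
       + 2 * p * matrix_of x $ 1 $ 3 + 2 * q * matrix_of x $ 2 $ 3"
  "matrix_of (V_coords a b c p q)
     = vector [vector [a, 0, p], vector [0, b, q], vector [p, q, c]]"
proof -
  have sym: "matrix_of x $ i $ j = matrix_of x $ j $ i" for i j
    using matrix_of[of x] by (simp add: transpose_def vec_eq_iff)
  show *: "matrix_of (V_coords a b c p q)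
     = vector [vector [a, 0, p], vector [0, b, q], vector [p, q, c]]"
    unfolding V_coords_def
    by (rule V_of_inverse) (simp add: transpose_def vec_eq_iff forall_3)
  show "x \<bullet> V_coords a b c p q =
     a * matrix_of x $ 1 $ 1 + b * matrix_of x $ 2 $ 2 + c * matrix_of x $ 3 $ 3
       + 2 * p * matrix_of x $ 1 $ 3 + 2 * q * matrix_of x $ 2 $ 3"
    using sym[of 3 1] sym[of 3 2]
    by (simp add: inner_V.rep_eq * inner_vec_def sum_3 algebra_simps)
qed

instantiation V :: euclidean_space
begin

definition Basis_V :: "V set" where
  "Basis_V = {V_coords 1 0 0 0 0, V_coords 0 1 0 0 0, V_coords 0 0 1 0 0,
              V_coords 0 0 0 (1 / sqrt 2) 0, V_coords 0 0 0 0 (1 / sqrt 2)}"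

instance
proof
  have eq: "V_coords a b c p q = V_coords a' b' c' p' q'
      \<longleftrightarrow> a = a' \<and> b = b' \<and> c = c' \<and> p = p' \<and> q = q'" for a b c p q a' b' c' p' q'
    by (auto simp: matrix_of_inject[symmetric] inner_V_coords vec_eq_iff forall_3)
  show "(Basis :: V set) \<noteq> {}" and "finite (Basis :: V set)"
    by (simp_all add: Basis_V_def)
  show "u \<bullet> v = (if u = v then 1 else 0)" if "u \<in> Basis" "v \<in> Basis" for u v :: V
    using that unfolding Basis_V_def
    by (elim insertE emptyE; hypsubst; simp add: inner_V_coords eq)
  show "(\<forall>u\<in>Basis. x \<bullet> u = 0) \<longleftrightarrow> x = 0" for x :: V
  proof -
    have "matrix_of x $ i $ j = matrix_of x $ j $ i" for i j
      using matrix_of[of x] by (simp add: transpose_def vec_eq_iff)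
    moreover have "matrix_of x $ 1 $ 2 = 0" using matrix_of[of x] by simp
    ultimately show ?thesis
      by (auto simp: Basis_V_def inner_V_coords matrix_of_inject[symmetric] zero_V.rep_eq
          vec_eq_iff forall_3)
  qed
qed

end

section \<open>Matrix functions\<close>

definition positive_definite :: "real^3^3 \<Rightarrow> bool" where
  "positive_definite A \<longleftrightarrow> transpose A = A \<and> (\<forall>w. w \<noteq> 0 \<longrightarrow> 0 < w \<bullet> (A *v w))"

text \<open>The index type \<open>3\<close> satisfies \<open>3 = 0\<close>, so its order is not the usual
  one and the entries above the diagonal are listed explicitly.\<close>

definition lower_triangular :: "real^3^3 \<Rightarrow> bool" where
  "lower_triangular A \<longleftrightarrow> A $ 1 $ 2 = 0 \<and> A $ 1 $ 3 = 0 \<and> A $ 2 $ 3 = 0"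

text \<open>The library's \<open>*\<close> on \<open>real^3^3\<close> is entrywise, so its \<open>exp\<close> is of no use here.\<close>

definition matrix_exp :: "real^3^3 \<Rightarrow> real^3^3" where
  "matrix_exp A = (\<Sum>n. (1 / fact n) *\<^sub>R (((**) A) ^^ n) (mat 1))"

definition complex_eigenvalue :: "real^3^3 \<Rightarrow> complex \<Rightarrow> bool" where
  "complex_eigenvalue A z \<longleftrightarrow>
     (\<exists>w :: complex^3. w \<noteq> 0 \<and> (\<chi> i j. complex_of_real (A $ i $ j)) *v w = z *s w)"

text \<open>Principal logarithm: the logarithm whose eigenvalues lie in the open strip
  \<open>\<bar>Im z\<bar> < \<pi>\<close>.\<close>

definition principal_log :: "real^3^3 \<Rightarrow> real^3^3" where
  "principal_log A =
     (THE L. matrix_exp L = A \<and> (\<forall>z. complex_eigenvalue L z \<longrightarrow> \<bar>Im z\<bar> < pi))"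

section \<open>The clan structure\<close>

definition \<Omega> :: "V set" where
  "\<Omega> = {x. positive_definite (matrix_of x)}"

definition cholesky :: "V \<Rightarrow> real^3^3" where
  "cholesky x = (THE T. lower_triangular T \<and> (\<forall>i. 0 < T $ i $ i)
     \<and> matrix_of x = T ** transpose T)"

definition lower_part :: "V \<Rightarrow> real^3^3" where
  "lower_part v = (THE A. lower_triangular A \<and> matrix_of v = A + transpose A)"

definition clan_product :: "V \<Rightarrow> V \<Rightarrow> V"  (infixl \<open>\<Delta>\<close> 70) where
  "u \<Delta> w = V_of (lower_part u ** matrix_of w + matrix_of w ** transpose (lower_part u))"

definition operator_trace :: "('a::euclidean_space \<Rightarrow> 'a) \<Rightarrow> real" where
  "operator_trace f = (\<Sum>b\<in>Basis. f b \<bullet> b)"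

definition Q_clan :: "V \<Rightarrow> V \<Rightarrow> real" where
  "Q_clan u v = operator_trace (\<lambda>w. (u \<Delta> v) \<Delta> w)"

definition norm_clan :: "V \<Rightarrow> real" where
  "norm_clan u = sqrt (Q_clan u u)"

definition Exp_clan :: "V \<Rightarrow> V" where
  "Exp_clan v = V_of (matrix_exp (lower_part v) ** transpose (matrix_exp (lower_part v)))"

definition Log_clan :: "V \<Rightarrow> V" where
  "Log_clan x = V_of (principal_log (cholesky x) + transpose (principal_log (cholesky x)))"

definition g_clan :: "V \<Rightarrow> V \<Rightarrow> V \<Rightarrow> real" where
  "g_clan x u v = Q_clan (frechet_derivative Log_clan (at x) u) (frechet_derivative Log_clan (at x) v)"

section \<open>Riemannian notions on an open subset of a Euclidean space\<close>

text \<open>Each piece is \<open>C\<^sup>1\<close> up to its endpoints.  The library's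
  \<open>valid_path\<close> allows an unbounded derivative at the break points, so that the length could
  be infinite and \<open>integral\<close> would return the value 0.\<close>

definition piecewise_C1_curve :: "(real \<Rightarrow> 'a::real_normed_vector) \<Rightarrow> bool" where
  "piecewise_C1_curve \<gamma> \<longleftrightarrow> (\<exists>n (p :: nat \<Rightarrow> real). p 0 = 0 \<and> p n = 1 \<and>
     (\<forall>i<n. p i < p (Suc i) \<and>
        (\<exists>\<gamma>'. continuous_on {p i..p (Suc i)} \<gamma>' \<and>
           (\<forall>t\<in>{p i..p (Suc i)}. (\<gamma> has_vector_derivative \<gamma>' t) (at t within {p i..p (Suc i)})))))"

definition curve_length ::
  "('a \<Rightarrow> 'a \<Rightarrow> 'a \<Rightarrow> real) \<Rightarrow> (real \<Rightarrow> 'a::real_normed_vector) \<Rightarrow> real" where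
  "curve_length g \<gamma> = integral {0..1}
     (\<lambda>t. sqrt (g (\<gamma> t) (vector_derivative \<gamma> (at t)) (vector_derivative \<gamma> (at t))))"

text \<open>The value 0 off \<open>S\<close> is a convention, as the locale \<open>Metric_space\<close>
  asks for symmetry and nonnegativity on the whole type.\<close>

definition riemannian_distance ::
  "'a set \<Rightarrow> ('a \<Rightarrow> 'a \<Rightarrow> 'a \<Rightarrow> real) \<Rightarrow> 'a::real_normed_vector \<Rightarrow> 'a \<Rightarrow> real" where
  "riemannian_distance S g x y =
     (if x \<in> S \<and> y \<in> S
      then Inf (curve_length g `
             {\<gamma>. piecewise_C1_curve \<gamma> \<and> \<gamma> ` {0..1} \<subseteq> S \<and> \<gamma> 0 = x \<and> \<gamma> 1 = y})
      else 0)"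

definition riemannian_complete ::
  "'a::real_normed_vector set \<Rightarrow> ('a \<Rightarrow> 'a \<Rightarrow> 'a \<Rightarrow> real) \<Rightarrow> bool" where
  "riemannian_complete S g \<longleftrightarrow>
     Metric_space S (riemannian_distance S g) \<and>
     Metric_space.mcomplete S (riemannian_distance S g)"

primrec C_k_on :: "nat \<Rightarrow> 'a::real_normed_vector set \<Rightarrow> ('a \<Rightarrow> 'b::real_normed_vector) \<Rightarrow> bool" where
  "C_k_on 0 S f \<longleftrightarrow> continuous_on S f"
| "C_k_on (Suc k) S f \<longleftrightarrow> (\<forall>x\<in>S. f differentiable (at x)) \<and>
     (\<forall>v. C_k_on k S (\<lambda>x. frechet_derivative f (at x) v))"

definition smooth_on :: "'a::real_normed_vector set \<Rightarrow> ('a \<Rightarrow> 'b::real_normed_vector) \<Rightarrow> bool" where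
  "smooth_on S f \<longleftrightarrow> (\<forall>k. C_k_on k S f)"

text \<open>For real-valued \<open>f\<close> this is the derivation \<open>X f\<close>; for vector fields
  \<open>f\<close> it is the standard flat connection of the vector space.\<close>

definition deriv_along ::
  "('a \<Rightarrow> 'a) \<Rightarrow> ('a::real_normed_vector \<Rightarrow> 'b::real_normed_vector) \<Rightarrow> 'a \<Rightarrow> 'b" where
  "deriv_along X f = (\<lambda>x. frechet_derivative f (at x) (X x))"

definition lie_bracket ::
  "('a \<Rightarrow> 'a) \<Rightarrow> ('a \<Rightarrow> 'a) \<Rightarrow> 'a \<Rightarrow> 'a::real_normed_vector" where
  "lie_bracket X Y = (\<lambda>x. deriv_along X Y x - deriv_along Y X x)"

text \<open>Vector fields on \<open>S\<close> are total functions that are smooth on \<open>S\<close>; all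
  equations are required on \<open>S\<close> only.  The axioms imply that the restriction of
  \<open>D X Y\<close> to \<open>S\<close> is determined by the restrictions of \<open>X\<close> and
  \<open>Y\<close>.\<close>

locale affine_connection =
  fixes S :: "'a::real_normed_vector set"
    and D :: "('a \<Rightarrow> 'a) \<Rightarrow> ('a \<Rightarrow> 'a) \<Rightarrow> ('a \<Rightarrow> 'a)"
  assumes smooth: "\<lbrakk>smooth_on S X; smooth_on S Y\<rbrakk> \<Longrightarrow> smooth_on S (D X Y)"
    and add_left: "\<lbrakk>smooth_on S X; smooth_on S X'; smooth_on S Y; x \<in> S\<rbrakk>
      \<Longrightarrow> D (\<lambda>z. X z + X' z) Y x = D X Y x + D X' Y x"
    and scale_left: "\<lbrakk>smooth_on S (f :: 'a \<Rightarrow> real); smooth_on S X; smooth_on S Y; x \<in> S\<rbrakk>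
      \<Longrightarrow> D (\<lambda>z. f z *\<^sub>R X z) Y x = f x *\<^sub>R D X Y x"
    and add_right: "\<lbrakk>smooth_on S X; smooth_on S Y; smooth_on S Y'; x \<in> S\<rbrakk>
      \<Longrightarrow> D X (\<lambda>z. Y z + Y' z) x = D X Y x + D X Y' x"
    and leibniz: "\<lbrakk>smooth_on S (f :: 'a \<Rightarrow> real); smooth_on S X; smooth_on S Y; x \<in> S\<rbrakk>
      \<Longrightarrow> D X (\<lambda>z. f z *\<^sub>R Y z) x = deriv_along X f x *\<^sub>R Y x + f x *\<^sub>R D X Y x"

definition torsion_free ::
  "'a::real_normed_vector set \<Rightarrow> (('a \<Rightarrow> 'a) \<Rightarrow> ('a \<Rightarrow> 'a) \<Rightarrow> ('a \<Rightarrow> 'a)) \<Rightarrow> bool" where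
  "torsion_free S D \<longleftrightarrow> (\<forall>X Y. smooth_on S X \<longrightarrow> smooth_on S Y \<longrightarrow>
     (\<forall>x\<in>S. D X Y x - D Y X x = lie_bracket X Y x))"

definition flat ::
  "'a::real_normed_vector set \<Rightarrow> (('a \<Rightarrow> 'a) \<Rightarrow> ('a \<Rightarrow> 'a) \<Rightarrow> ('a \<Rightarrow> 'a)) \<Rightarrow> bool" where
  "flat S D \<longleftrightarrow> (\<forall>X Y Z. smooth_on S X \<longrightarrow> smooth_on S Y \<longrightarrow> smooth_on S Z \<longrightarrow>
     (\<forall>x\<in>S. D X (D Y Z) x - D Y (D X Z) x - D (lie_bracket X Y) Z x = 0))"

definition metric_compatible ::
  "'a::real_normed_vector set \<Rightarrow> ('a \<Rightarrow> 'a \<Rightarrow> 'a \<Rightarrow> real) \<Rightarrow>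
     (('a \<Rightarrow> 'a) \<Rightarrow> ('a \<Rightarrow> 'a) \<Rightarrow> ('a \<Rightarrow> 'a)) \<Rightarrow> bool" where
  "metric_compatible S g D \<longleftrightarrow>
     (\<forall>X Y Z. smooth_on S X \<longrightarrow> smooth_on S Y \<longrightarrow> smooth_on S Z \<longrightarrow>
       (\<forall>x\<in>S. deriv_along X (\<lambda>z. g z (Y z) (Z z)) x
                = g x (D X Y x) (Z x) + g x (Y x) (D X Z x)))"

text \<open>The last conjunct makes \<open>D\<close> the only torsion-free metric connection, up to values
  off \<open>S\<close>.\<close>

definition is_levi_civita ::
  "'a::real_normed_vector set \<Rightarrow> ('a \<Rightarrow> 'a \<Rightarrow> 'a \<Rightarrow> real) \<Rightarrow>
     (('a \<Rightarrow> 'a) \<Rightarrow> ('a \<Rightarrow> 'a) \<Rightarrow> ('a \<Rightarrow> 'a)) \<Rightarrow> bool" where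
  "is_levi_civita S g D \<longleftrightarrow>
     affine_connection S D \<and> torsion_free S D \<and> metric_compatible S g D \<and>
     (\<forall>D'. affine_connection S D' \<and> torsion_free S D' \<and> metric_compatible S g D' \<longrightarrow>
        (\<forall>X Y. smooth_on S X \<longrightarrow> smooth_on S Y \<longrightarrow> (\<forall>x\<in>S. D' X Y x = D X Y x)))"

text \<open>Push-forward of a vector field along a diffeomorphism \<open>F\<close> with inverse
  \<open>G\<close>.\<close>

definition push_forward ::
  "('a::real_normed_vector \<Rightarrow> 'b::real_normed_vector) \<Rightarrow> ('b \<Rightarrow> 'a) \<Rightarrow> ('a \<Rightarrow> 'a) \<Rightarrow> 'b \<Rightarrow> 'b" where
  "push_forward F G X = (\<lambda>y. frechet_derivative F (at (G y)) (X (G y)))"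

definition nabla_clan :: "(V \<Rightarrow> V) \<Rightarrow> (V \<Rightarrow> V) \<Rightarrow> (V \<Rightarrow> V)" where
  "nabla_clan U W = push_forward Exp_clan Log_clan
     (deriv_along (push_forward Log_clan Exp_clan U) (push_forward Log_clan Exp_clan W))"

end

theory Submission
  imports Defs "HOL-Computational_Algebra.Fundamental_Theorem_Algebra"
begin

text \<open>The operator trace gives \<open>Q\<^sub>\<Delta>(u, v) = \<langle>A u, A v\<rangle>\<close> for an explicit diagonal map
  \<open>A\<close>, so \<open>A \<circ> Log\<^sub>\<Delta>\<close> is an isometry of \<open>\<Omega>\<close> onto a Euclidean space. Curves
  have the length of their image, straight segments pull back to minimizing curves, and the flat
  connection pulls back to \<open>\<nabla>\<^sup>\<Delta>\<close>; torsion-freeness and flatness both reduce to the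
  symmetry of second derivatives, \<open>X (Y f) - Y (X f) = [X, Y] f\<close>.

  That \<open>Log\<^sub>\<Delta>\<close> is a smooth inverse of \<open>Exp\<^sub>\<Delta>\<close> is read off from closed formulas: the
  exponential of a lower triangular matrix involves only \<open>exp\<close> and the entire positive function
  \<open>(exp t - 1) / t\<close>. The principal logarithm is unique among all real matrices: the
  strip condition forces a real spectrum, as the exponential has positive eigenvalues, and if
  \<open>exp X = exp Y\<close> with both spectra real, then the entries of \<open>exp (t X) - exp (t Y)\<close>
  are real exponential polynomials with real exponents that vanish at every natural number, hence
  everywhere.\<close>

section \<open>Calculus of smooth maps\<close>

text \<open>The definite description in \<open>principal_log\<close> shapes the matrix part. A
  competing logarithm is an arbitrary real matrix, not known to be triangular, so it cannot be
  compared entry by entry; what can be learned about it is its spectrum. Real eigenvalues give an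
  annihilating polynomial with real roots, and this is all that the injectivity argument uses.

  The off-diagonal entries of the exponential are divided differences of \<open>exp\<close>. Written
  with \<open>(exp t - 1) / t\<close> they need no separate case for equal diagonal entries, and
  positivity of this function lets it be divided out when solving for the logarithm.

  Only \<open>Log_clan (Exp_clan v) = v\<close> is proved from the definitions. An explicit right
  inverse of \<open>Exp_clan\<close> on \<open>\<Omega>\<close> must then agree with
  \<open>Log_clan\<close>, which yields both the other composition and smoothness.

  The weights of the diagonal map come from the trace of left multiplication by
  \<open>V_coords a b c p q\<close>: it contributes \<open>a\<close>, \<open>b\<close>,
  \<open>c\<close> on the diagonal coordinates and \<open>(a + c) / 2\<close>,
  \<open>(b + c) / 2\<close> on the two off-diagonal ones, in total
  \<open>3 / 2 * (a + b) + 2 * c\<close>.\<close>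

lemma C_k_on_cong:
  fixes f g :: "'a::real_normed_vector \<Rightarrow> 'b::real_normed_vector"
  assumes "open S" "\<And>x. x \<in> S \<Longrightarrow> f x = g x" "C_k_on k S f"
  shows "C_k_on k S g"
  using assms(2,3)
proof (induction k arbitrary: f g)
  case 0
  then show ?case by (simp cong: continuous_on_cong)
next
  case (Suc k)
  have g: "(g has_derivative frechet_derivative f (at x)) (at x)" if "x \<in> S" for x
  proof (rule has_derivative_transform_within_open[OF _ \<open>open S\<close> that])
    show "(f has_derivative frechet_derivative f (at x)) (at x)"
      using Suc.prems(2) that frechet_derivative_works by auto
  qed (rule Suc.prems(1))
  have "C_k_on k S (\<lambda>x. frechet_derivative g (at x) v)" for v
    by (rule Suc.IH[of "\<lambda>x. frechet_derivative f (at x) v"])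
      (use Suc.prems(2) in \<open>simp_all add: frechet_derivative_at[OF g, symmetric]\<close>)
  then show ?case using g by (auto simp: differentiable_def)
qed

text \<open>On an open set any explicit formula for the derivative may replace
  \<open>frechet_derivative\<close>, so the inductions that follow can compute with product and
  chain rules.\<close>

lemma C_k_on_Suc:
  fixes f :: "'a::real_normed_vector \<Rightarrow> 'b::real_normed_vector"
  assumes "open S" "\<And>x. x \<in> S \<Longrightarrow> (f has_derivative f' x) (at x)" "\<And>v. C_k_on k S (\<lambda>x. f' x v)"
  shows "C_k_on (Suc k) S f"
proof -
  have "C_k_on k S (\<lambda>x. frechet_derivative f (at x) v)" for v
    by (rule C_k_on_cong[OF assms(1) _ assms(3)]) (simp add: frechet_derivative_at[OF assms(2), symmetric])
  then show ?thesis using assms(2) by (auto simp: differentiable_def)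
qed

lemma C_k_on_has_derivative:
  assumes "C_k_on (Suc k) S f" "x \<in> S"
  shows "(f has_derivative frechet_derivative f (at x)) (at x)"
  using assms by (simp add: frechet_derivative_works)

lemma C_k_on_SucD: "C_k_on (Suc k) S f \<Longrightarrow> C_k_on k S f"
proof (induction k arbitrary: f)
  case 0
  then show ?case
    by (simp add: continuous_at_imp_continuous_on differentiable_imp_continuous_within)
next
  case (Suc k)
  then show ?case by (meson C_k_on.simps(2))
qed

lemma C_k_on_const: "C_k_on k S (\<lambda>_. c)"
  by (induction k arbitrary: c) simp_all

lemma C_k_on_bounded_linear:
  assumes "bounded_linear f" shows "C_k_on k S f"
proof (cases k)
  case 0
  then show ?thesis using linear_continuous_on[OF assms] by simp
next
  case (Suc n)
  have "(f has_derivative f) (at x)" for x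
    by (rule bounded_linear_imp_has_derivative[OF assms])
  then show ?thesis
    using frechet_derivative_at[of f f] by (auto simp: Suc differentiable_def C_k_on_const)
qed

lemma C_k_on_add:
  assumes "open S" "C_k_on k S f" "C_k_on k S g"
  shows "C_k_on k S (\<lambda>x. f x + g x)"
  using assms(2,3)
proof (induction k arbitrary: f g)
  case 0
  then show ?case by (simp add: continuous_on_add)
next
  case (Suc k)
  note d = C_k_on_has_derivative[OF Suc.prems(1)] C_k_on_has_derivative[OF Suc.prems(2)]
  show ?case
    by (rule C_k_on_Suc[OF \<open>open S\<close> has_derivative_add[OF d]])
      (use Suc in simp_all)
qed

lemma C_k_on_bilinear:
  assumes "open S" "bounded_bilinear B" "C_k_on k S f" "C_k_on k S g"
  shows "C_k_on k S (\<lambda>x. B (f x) (g x))"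
  using assms(3,4)
proof (induction k arbitrary: f g)
  case 0
  then show ?case using bounded_bilinear.continuous_on[OF assms(2)] by simp
next
  case (Suc k)
  note d = C_k_on_has_derivative[OF Suc.prems(1)] C_k_on_has_derivative[OF Suc.prems(2)]
  show ?case
    by (rule C_k_on_Suc[OF \<open>open S\<close> bounded_bilinear.FDERIV[OF assms(2) d]])
      (use Suc C_k_on_SucD[OF Suc.prems(1)] C_k_on_SucD[OF Suc.prems(2)] in
        \<open>simp_all add: C_k_on_add[OF \<open>open S\<close>]\<close>)
qed

lemma C_k_on_sum:
  assumes "open S" "\<And>i. i \<in> I \<Longrightarrow> C_k_on k S (f i)"
  shows "C_k_on k S (\<lambda>x. \<Sum>i\<in>I. f i x)"
  using assms(2) by (induction I rule: infinite_finite_induct)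
    (simp_all add: C_k_on_const C_k_on_add[OF assms(1)])

text \<open>\<open>C_k_on\<close> controls derivatives in fixed directions only. Expansion in the
  basis turns a direction that varies with the point into scalar coefficients times derivatives in
  fixed directions; chain rule, vector fields and speeds of curves all rely on this.\<close>

lemma frechet_derivative_sum_Basis:
  fixes f :: "'a::euclidean_space \<Rightarrow> 'b::real_normed_vector"
  assumes "f differentiable (at x)"
  shows "frechet_derivative f (at x) v = (\<Sum>b\<in>Basis. (v \<bullet> b) *\<^sub>R frechet_derivative f (at x) b)"
proof -
  interpret linear "frechet_derivative f (at x)"
    by (rule linear_frechet_derivative[OF assms])
  have "frechet_derivative f (at x) v = frechet_derivative f (at x) (\<Sum>b\<in>Basis. (v \<bullet> b) *\<^sub>R b)"
    by (simp add: euclidean_representation)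
  then show ?thesis by (simp add: sum scaleR)
qed

text \<open>The map \<open>f\<close> stays fixed while \<open>g\<close> varies in the induction: the
  derivative is a sum of coefficients coming from \<open>f\<close> times composites of
  \<open>f\<close> with directional derivatives of \<open>g\<close>, to which the induction
  hypothesis applies.\<close>

lemma C_k_on_compose:
  fixes f :: "'a::real_normed_vector \<Rightarrow> 'b::euclidean_space"
    and g :: "'b \<Rightarrow> 'c::real_normed_vector"
  assumes "open S" "f ` S \<subseteq> T" "C_k_on k S f" "C_k_on k T g"
  shows "C_k_on k S (\<lambda>x. g (f x))"
  using assms(3,4)
proof (induction k arbitrary: g)
  case 0
  then show ?case using continuous_on_compose2[of T g S f] \<open>f ` S \<subseteq> T\<close> by simp
next
  case (Suc k)
  let ?f' = "\<lambda>x. frechet_derivative f (at x)"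
  let ?g' = "\<lambda>y. frechet_derivative g (at y)"
  have f: "C_k_on k S f" using Suc.prems(1) by (rule C_k_on_SucD)
  show ?case
  proof (rule C_k_on_Suc[OF \<open>open S\<close>])
    fix x assume "x \<in> S"
    then have d: "(f has_derivative ?f' x) (at x)" "(g has_derivative ?g' (f x)) (at (f x))"
      using Suc.prems \<open>f ` S \<subseteq> T\<close> by (auto simp: frechet_derivative_works)
    show "((\<lambda>x. g (f x)) has_derivative (\<lambda>v. \<Sum>b\<in>Basis. (?f' x v \<bullet> b) *\<^sub>R ?g' (f x) b)) (at x)"
      using has_derivative_compose[OF d] d(2)
      by (subst frechet_derivative_sum_Basis[symmetric]) (auto simp: differentiable_def)
  next
    fix v
    have "C_k_on k S (\<lambda>x. ?g' (f x) b)" for b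
      using Suc.IH[of "\<lambda>y. ?g' y b"] f Suc.prems(2) by simp
    then show "C_k_on k S (\<lambda>x. \<Sum>b\<in>Basis. (?f' x v \<bullet> b) *\<^sub>R ?g' (f x) b)"
      using Suc.prems(1)
      by (intro C_k_on_sum C_k_on_bilinear[OF \<open>open S\<close> bounded_bilinear_scaleR]
          C_k_on_bilinear[OF \<open>open S\<close> bounded_bilinear_inner] C_k_on_const \<open>open S\<close>) simp_all
  qed
qed

lemma smooth_on_cong:
  assumes "open S" "\<And>x. x \<in> S \<Longrightarrow> f x = g x" "smooth_on S f"
  shows "smooth_on S g"
  using assms C_k_on_cong unfolding smooth_on_def by blast

section \<open>Closure properties of smooth maps\<close>

named_theorems smooth_intros

lemma smooth_on_const [smooth_intros]: "smooth_on S (\<lambda>_. c)"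
  by (simp add: smooth_on_def C_k_on_const)

lemma smooth_on_bounded_linear: "bounded_linear f \<Longrightarrow> smooth_on S f"
  by (simp add: smooth_on_def C_k_on_bounded_linear)

lemma smooth_on_bilinear:
  "open S \<Longrightarrow> bounded_bilinear B \<Longrightarrow> smooth_on S f \<Longrightarrow> smooth_on S g
    \<Longrightarrow> smooth_on S (\<lambda>x. B (f x) (g x))"
  by (simp add: smooth_on_def C_k_on_bilinear)

lemmas smooth_on_scaleR [smooth_intros] = smooth_on_bilinear[OF _ bounded_bilinear_scaleR]
  and smooth_on_inner [smooth_intros] = smooth_on_bilinear[OF _ bounded_bilinear_inner]

lemma smooth_on_mult [smooth_intros]:
  fixes f g :: "'a::real_normed_vector \<Rightarrow> 'b::real_normed_algebra"
  shows "open S \<Longrightarrow> smooth_on S f \<Longrightarrow> smooth_on S g \<Longrightarrow> smooth_on S (\<lambda>x. f x * g x)"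
  by (rule smooth_on_bilinear[OF _ bounded_bilinear_mult])

lemma smooth_on_add [smooth_intros]:
  "open S \<Longrightarrow> smooth_on S f \<Longrightarrow> smooth_on S g \<Longrightarrow> smooth_on S (\<lambda>x. f x + g x)"
  by (simp add: smooth_on_def C_k_on_add)

lemma smooth_on_sum [smooth_intros]:
  "open S \<Longrightarrow> (\<And>i. i \<in> I \<Longrightarrow> smooth_on S (f i)) \<Longrightarrow> smooth_on S (\<lambda>x. \<Sum>i\<in>I. f i x)"
  by (simp add: smooth_on_def C_k_on_sum)

lemma smooth_on_compose:
  fixes f :: "'a::real_normed_vector \<Rightarrow> 'b::euclidean_space"
  assumes "smooth_on T g" "open S" "smooth_on S f" "\<And>x. x \<in> S \<Longrightarrow> f x \<in> T"
  shows "smooth_on S (\<lambda>x. g (f x))"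
  using assms C_k_on_compose[OF \<open>open S\<close>, of f T _ g] by (simp add: smooth_on_def image_subset_iff)

lemma smooth_on_linear_compose:
  fixes f :: "'a::real_normed_vector \<Rightarrow> 'b::euclidean_space"
  shows "bounded_linear g \<Longrightarrow> open S \<Longrightarrow> smooth_on S f \<Longrightarrow> smooth_on S (\<lambda>x. g (f x))"
  by (rule smooth_on_compose[OF smooth_on_bounded_linear]) auto

lemma smooth_on_minus [smooth_intros]:
  fixes f :: "'a::real_normed_vector \<Rightarrow> 'b::euclidean_space"
  shows "open S \<Longrightarrow> smooth_on S f \<Longrightarrow> smooth_on S (\<lambda>x. - f x)"
  by (rule smooth_on_linear_compose[OF bounded_linear_minus[OF bounded_linear_ident]])

lemma smooth_on_diff [smooth_intros]:
  fixes f :: "'a::real_normed_vector \<Rightarrow> 'b::euclidean_space"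
  shows "open S \<Longrightarrow> smooth_on S f \<Longrightarrow> smooth_on S g \<Longrightarrow> smooth_on S (\<lambda>x. f x - g x)"
  using smooth_on_add[of S f "\<lambda>x. - g x"] smooth_on_minus[of S g] by simp

lemma smooth_on_has_derivative:
  assumes "smooth_on S f" "x \<in> S"
  shows "(f has_derivative frechet_derivative f (at x)) (at x)"
  using assms C_k_on_has_derivative unfolding smooth_on_def by blast

lemma smooth_on_differentiable: "smooth_on S f \<Longrightarrow> x \<in> S \<Longrightarrow> f differentiable (at x)"
  using smooth_on_has_derivative differentiableI by blast

lemma smooth_on_continuous_on: "smooth_on S f \<Longrightarrow> continuous_on S f"
  unfolding smooth_on_def by (metis C_k_on.simps(1))

lemma smooth_on_subset: "smooth_on T f \<Longrightarrow> S \<subseteq> T \<Longrightarrow> smooth_on S f"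
proof -
  have "C_k_on k T f \<Longrightarrow> S \<subseteq> T \<Longrightarrow> C_k_on k S f" for k
    by (induction k arbitrary: f) (auto intro: continuous_on_subset)
  then show "smooth_on T f \<Longrightarrow> S \<subseteq> T \<Longrightarrow> smooth_on S f" by (auto simp: smooth_on_def)
qed

lemma smooth_on_frechet_derivative:
  "smooth_on S f \<Longrightarrow> smooth_on S (\<lambda>x. frechet_derivative f (at x) v)"
  unfolding smooth_on_def by (metis C_k_on.simps(2))

lemma smooth_on_deriv_along:
  fixes f :: "'a::euclidean_space \<Rightarrow> 'b::euclidean_space"
  assumes "open S" "smooth_on S X" "smooth_on S f"
  shows "smooth_on S (deriv_along X f)"
proof (rule smooth_on_cong[OF \<open>open S\<close>])
  show "smooth_on S (\<lambda>x. \<Sum>b\<in>Basis. (X x \<bullet> b) *\<^sub>R frechet_derivative f (at x) b)"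
    by (intro smooth_intros smooth_on_frechet_derivative assms)
qed (simp add: deriv_along_def frechet_derivative_sum_Basis[symmetric]
    smooth_on_differentiable[OF assms(3)])

section \<open>Smoothness of elementary real functions\<close>

lemma C_k_on_real_Suc:
  fixes f :: "real \<Rightarrow> real"
  assumes "open S" "\<And>x. x \<in> S \<Longrightarrow> (f has_real_derivative f' x) (at x)" "C_k_on k S f'"
  shows "C_k_on (Suc k) S f"
proof (rule C_k_on_Suc[OF \<open>open S\<close>])
  show "(f has_derivative (\<lambda>v. f' x * v)) (at x)" if "x \<in> S" for x
    using assms(2)[OF that] by (simp add: has_field_derivative_def)
  show "C_k_on k S (\<lambda>x. f' x * v)" for v
    by (intro C_k_on_bilinear[OF \<open>open S\<close> bounded_bilinear_mult] assms C_k_on_const)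
qed

text \<open>Termwise differentiation gives another everywhere convergent series, so the coefficients
  vary in the induction. The purpose is a quotient with a removable singularity.\<close>

lemma smooth_on_powser:
  fixes c :: "nat \<Rightarrow> real"
  assumes "\<And>x. summable (\<lambda>n. c n * x ^ n)"
  shows "smooth_on UNIV (\<lambda>x. \<Sum>n. c n * x ^ n)"
  unfolding smooth_on_def
proof
  fix k show "C_k_on k UNIV (\<lambda>x. \<Sum>n. c n * x ^ n)"
    using assms
  proof (induction k arbitrary: c)
    case 0
    then show ?case
      by (auto intro: continuous_at_imp_continuous_on isCont_powser_converges_everywhere)
  next
    case (Suc k)
    then show ?case
      by (intro C_k_on_real_Suc[OF open_UNIV termdiffs_strong_converges_everywhere] Suc.IH
        termdiff_converges_all) auto
  qed
qed

lemma smooth_on_exp: "smooth_on UNIV (exp :: real \<Rightarrow> real)"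
proof -
  have "C_k_on k UNIV (exp :: real \<Rightarrow> real)" for k
    by (induction k) (simp add: continuous_on_exp, rule C_k_on_real_Suc, auto intro: DERIV_exp)
  then show ?thesis by (simp add: smooth_on_def)
qed

lemma smooth_on_inverse: "smooth_on {x. x \<noteq> 0} (inverse :: real \<Rightarrow> real)"
proof -
  have o: "open {x::real. x \<noteq> 0}" by (simp add: open_Collect_neq)
  have "C_k_on k {x. x \<noteq> 0} (inverse :: real \<Rightarrow> real)" for k
  proof (induction k)
    case 0
    show ?case by (auto intro: continuous_intros)
  next
    case (Suc k)
    show ?case
    proof (rule C_k_on_real_Suc[OF o])
      show "(inverse has_real_derivative (- 1) * (inverse x * inverse x)) (at x)" if "x \<in> {x. x \<noteq> 0}" for x :: real
        using that DERIV_inverse[of x UNIV] by (simp add: power2_eq_square numeral_2_eq_2)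
      show "C_k_on k {x::real. x \<noteq> 0} (\<lambda>x. (- 1) * (inverse x * inverse x))"
        by (intro C_k_on_bilinear[OF o bounded_bilinear_mult] Suc C_k_on_const)
    qed
  qed
  then show ?thesis by (simp add: smooth_on_def)
qed

lemma smooth_on_ln: "smooth_on {0<..} (ln :: real \<Rightarrow> real)"
proof -
  have "C_k_on k {0<..} (ln :: real \<Rightarrow> real)" for k
  proof (cases k)
    case 0
    show ?thesis unfolding 0 by (auto intro: continuous_intros)
  next
    case (Suc n)
    have "C_k_on n {0<..} (inverse :: real \<Rightarrow> real)"
      using smooth_on_subset[OF smooth_on_inverse, of "{0<..}"] by (auto simp: smooth_on_def)
    then show ?thesis unfolding Suc
      by (intro C_k_on_real_Suc[where f' = inverse]) (auto intro: DERIV_ln)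
  qed
  then show ?thesis by (simp add: smooth_on_def)
qed

lemma smooth_on_divide [smooth_intros]:
  fixes f g :: "'a::real_normed_vector \<Rightarrow> real"
  assumes "open S" "smooth_on S f" "smooth_on S g" "\<And>x. x \<in> S \<Longrightarrow> g x \<noteq> 0"
  shows "smooth_on S (\<lambda>x. f x / g x)"
  unfolding divide_inverse using assms by (intro smooth_intros smooth_on_compose[OF smooth_on_inverse]) auto

section \<open>Second derivatives and Lie brackets\<close>

lemma has_real_derivative_on_line:
  assumes "(F has_derivative F') (at (a + s *\<^sub>R u))"
  shows "((\<lambda>s. F (a + s *\<^sub>R u)) has_real_derivative F' u) (at s)"
proof -
  interpret bounded_linear F' by (rule has_derivative_bounded_linear[OF assms])
  have "((\<lambda>s. a + s *\<^sub>R u) has_derivative (\<lambda>t. t *\<^sub>R u)) (at s)"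
    by (auto intro!: derivative_eq_intros)
  from has_derivative_compose[OF this assms] show ?thesis
    unfolding has_field_derivative_def by (rule has_derivative_eq_rhs) (simp add: scaleR fun_eq_iff)
qed

text \<open>The mean value theorem is applied twice, first along \<open>u\<close> to a difference of
  two translates of \<open>f\<close>, then along \<open>v\<close> to the derivative. The left-hand
  side is symmetric in \<open>u\<close> and \<open>v\<close>, so exchanging them expresses it
  through the other mixed derivative.\<close>

lemma second_difference_mean_value:
  fixes f :: "'a::real_normed_vector \<Rightarrow> real"
  assumes f: "C_k_on 2 S f" and "0 < h"
    and S: "\<And>s t. s \<in> {0..h} \<Longrightarrow> t \<in> {0..h} \<Longrightarrow> x + s *\<^sub>R u + t *\<^sub>R v \<in> S"
  shows "\<exists>s\<in>{0..h}. \<exists>t\<in>{0..h}. f (x + h *\<^sub>R u + h *\<^sub>R v) - f (x + h *\<^sub>R u) - f (x + h *\<^sub>R v) + f x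
    = h * (h * frechet_derivative (\<lambda>y. frechet_derivative f (at y) u) (at (x + s *\<^sub>R u + t *\<^sub>R v)) v)"
proof -
  let ?D = "\<lambda>y. frechet_derivative f (at y) u"
  have d1: "(f has_derivative frechet_derivative f (at y)) (at y)" if "y \<in> S" for y
    using C_k_on_has_derivative[OF f[unfolded numeral_2_eq_2] that] .
  have d2: "(?D has_derivative frechet_derivative ?D (at y)) (at y)" if "y \<in> S" for y
    using f that by (auto simp: numeral_2_eq_2 intro: C_k_on_has_derivative[of 0 S])
  have "((\<lambda>s. f (x + h *\<^sub>R v + s *\<^sub>R u) - f (x + s *\<^sub>R u)) has_real_derivative
      ?D (x + h *\<^sub>R v + s *\<^sub>R u) - ?D (x + s *\<^sub>R u)) (at s)" if "0 \<le> s" "s \<le> h" for s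
    using S[of s h] S[of s 0] that \<open>0 < h\<close>
    by (intro derivative_intros has_real_derivative_on_line d1) (simp_all add: algebra_simps)
  from MVT2[OF \<open>0 < h\<close> this] obtain s where s: "0 < s" "s < h"
    "f (x + h *\<^sub>R v + h *\<^sub>R u) - f (x + h *\<^sub>R u) - (f (x + h *\<^sub>R v) - f x)
      = h * (?D (x + h *\<^sub>R v + s *\<^sub>R u) - ?D (x + s *\<^sub>R u))" by auto
  have "((\<lambda>t. ?D (x + s *\<^sub>R u + t *\<^sub>R v)) has_real_derivative
      frechet_derivative ?D (at (x + s *\<^sub>R u + t *\<^sub>R v)) v) (at t)" if "0 \<le> t" "t \<le> h" for t
    using S[of s t] that s by (intro has_real_derivative_on_line d2) simp
  from MVT2[OF \<open>0 < h\<close> this] obtain t where t: "0 < t" "t < h"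
    "?D (x + s *\<^sub>R u + h *\<^sub>R v) - ?D (x + s *\<^sub>R u)
      = h * frechet_derivative ?D (at (x + s *\<^sub>R u + t *\<^sub>R v)) v" by auto
  have "f (x + h *\<^sub>R u + h *\<^sub>R v) - f (x + h *\<^sub>R u) - f (x + h *\<^sub>R v) + f x
    = h * (h * frechet_derivative ?D (at (x + s *\<^sub>R u + t *\<^sub>R v)) v)"
    using s(3) t(3) by (simp add: algebra_simps)
  then show ?thesis using s t by (intro bexI[of _ s] bexI[of _ t]) auto
qed

lemma second_derivative_symmetric_real:
  fixes f :: "'a::real_normed_vector \<Rightarrow> real"
  assumes "open S" "x \<in> S" and f: "C_k_on 2 S f"
  shows "frechet_derivative (\<lambda>y. frechet_derivative f (at y) u) (at x) v
       = frechet_derivative (\<lambda>y. frechet_derivative f (at y) v) (at x) u"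
proof -
  let ?D = "\<lambda>u v y. frechet_derivative (\<lambda>y. frechet_derivative f (at y) u) (at y) v"
  have "dist (?D u v x) (?D v u x) \<le> e" if "0 < e" for e
  proof -
    have cont: "continuous (at x) (?D u v)" for u v
      using f \<open>open S\<close> \<open>x \<in> S\<close> by (auto simp: numeral_2_eq_2 continuous_on_eq_continuous_at)
    have "\<exists>d>0. \<forall>y. dist y x < d \<longrightarrow> dist (?D u v y) (?D u v x) < e / 2" for u v
      using cont[of u v] \<open>0 < e\<close> unfolding continuous_at_eps_delta by (metis half_gt_zero)
    then obtain d1 d2 where d: "d1 > 0" "d2 > 0"
      "\<And>y. dist y x < d1 \<Longrightarrow> dist (?D u v y) (?D u v x) < e / 2"
      "\<And>y. dist y x < d2 \<Longrightarrow> dist (?D v u y) (?D v u x) < e / 2"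
      by metis
    obtain d3 where d3: "d3 > 0" "ball x d3 \<subseteq> S"
      using \<open>open S\<close> \<open>x \<in> S\<close> openE by blast
    define d where "d = min d1 (min d2 d3)"
    \<comment> \<open>The summand 1 avoids division by zero for \<open>u = v = 0\<close> and makes
      \<open>h * (norm u + norm v) < d\<close> strict, which keeps the whole parallelogram within
      distance \<open>d\<close> of \<open>x\<close>.\<close>
    define h where "h = d / (norm u + norm v + 1)"
    have pos: "0 < d" "0 < norm u + norm v + 1"
      using d d3 norm_ge_zero[of u] norm_ge_zero[of v] by (auto simp: d_def simp del: norm_ge_zero)
    then have h: "0 < h" "h * (norm u + norm v) < d"
      by (auto simp: h_def field_simps)
    have near: "dist (x + s *\<^sub>R u + t *\<^sub>R v) x < d" if "s \<in> {0..h}" "t \<in> {0..h}" for s t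
    proof -
      have "dist (x + s *\<^sub>R u + t *\<^sub>R v) x \<le> s * norm u + t * norm v"
        using norm_triangle_ineq[of "s *\<^sub>R u" "t *\<^sub>R v"] that by (simp add: dist_norm add.assoc)
      also have "\<dots> \<le> h * norm u + h * norm v"
        using that by (intro add_mono mult_right_mono) auto
      finally show ?thesis using h by (simp add: algebra_simps)
    qed
    then have inS: "x + s *\<^sub>R u + t *\<^sub>R v \<in> S" if "s \<in> {0..h}" "t \<in> {0..h}" for s t
      using d3 that by (auto simp: d_def dist_commute subset_iff)
    then have inS': "x + s *\<^sub>R v + t *\<^sub>R u \<in> S" if "s \<in> {0..h}" "t \<in> {0..h}" for s t
      using that by (metis add.assoc add.commute)
    obtain s t where st: "s \<in> {0..h}" "t \<in> {0..h}"
      "f (x + h *\<^sub>R u + h *\<^sub>R v) - f (x + h *\<^sub>R u) - f (x + h *\<^sub>R v) + f x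
        = h * (h * ?D u v (x + s *\<^sub>R u + t *\<^sub>R v))"
      using second_difference_mean_value[OF f h(1), of x u v] inS by blast
    obtain s' t' where st': "s' \<in> {0..h}" "t' \<in> {0..h}"
      "f (x + h *\<^sub>R v + h *\<^sub>R u) - f (x + h *\<^sub>R v) - f (x + h *\<^sub>R u) + f x
        = h * (h * ?D v u (x + s' *\<^sub>R v + t' *\<^sub>R u))"
      using second_difference_mean_value[OF f h(1), of x v u] inS' by blast
    have "h * (h * ?D u v (x + s *\<^sub>R u + t *\<^sub>R v)) = h * (h * ?D v u (x + s' *\<^sub>R v + t' *\<^sub>R u))"
      unfolding st(3)[symmetric] st'(3)[symmetric] by (simp add: add_ac)
    then have eq: "?D u v (x + s *\<^sub>R u + t *\<^sub>R v) = ?D v u (x + s' *\<^sub>R v + t' *\<^sub>R u)"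
      using h(1) by simp
    have "dist (x + s *\<^sub>R u + t *\<^sub>R v) x < d1" using near[OF st(1,2)] by (simp add: d_def)
    then have 1: "dist (?D u v (x + s *\<^sub>R u + t *\<^sub>R v)) (?D u v x) < e / 2" by (rule d)
    have "dist (x + s' *\<^sub>R v + t' *\<^sub>R u) x < d2"
      using near[OF st'(2,1)] by (simp add: d_def add_ac)
    then have 2: "dist (?D v u (x + s' *\<^sub>R v + t' *\<^sub>R u)) (?D v u x) < e / 2" by (rule d)
    show ?thesis using 1 2 unfolding eq dist_real_def by linarith
  qed
  then have "dist (?D u v x) (?D v u x) \<le> 0" by (rule field_le_epsilon[of _ 0, simplified])
  then show ?thesis by simp
qed

lemma frechet_derivative_linear_compose:
  assumes "bounded_linear g" "f differentiable (at x)"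
  shows "frechet_derivative (\<lambda>y. g (f y)) (at x) v = g (frechet_derivative f (at x) v)"
  using frechet_derivative_at[OF bounded_linear.has_derivative[OF assms(1)
        assms(2)[unfolded frechet_derivative_works]]] by metis

lemma frechet_derivative_cong:
  assumes "open S" "x \<in> S" "f differentiable (at x)" "\<And>y. y \<in> S \<Longrightarrow> f y = g y"
  shows "frechet_derivative g (at x) = frechet_derivative f (at x)"
  using frechet_derivative_transform_within_open[OF assms(3,1,2,4)] by simp

lemma second_derivative_symmetric:
  fixes f :: "'a::real_normed_vector \<Rightarrow> 'b::euclidean_space"
  assumes "open S" "x \<in> S" and f: "smooth_on S f"
  shows "frechet_derivative (\<lambda>y. frechet_derivative f (at y) u) (at x) v
       = frechet_derivative (\<lambda>y. frechet_derivative f (at y) v) (at x) u"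
proof (rule euclidean_eqI)
  fix b :: 'b
  have bl: "bounded_linear (\<lambda>z. z \<bullet> b)" by (rule bounded_linear_inner_left)
  have d1: "f differentiable (at y)" if "y \<in> S" for y
    using smooth_on_differentiable[OF f that] .
  have d2: "(\<lambda>y. frechet_derivative f (at y) u) differentiable (at x)" for u
    by (rule smooth_on_differentiable[OF smooth_on_frechet_derivative[OF f] \<open>x \<in> S\<close>])
  have "frechet_derivative (\<lambda>y. frechet_derivative f (at y) u) (at x) v \<bullet> b
      = frechet_derivative (\<lambda>y. frechet_derivative (\<lambda>y. f y \<bullet> b) (at y) u) (at x) v" for u v
  proof -
    have "frechet_derivative (\<lambda>y. frechet_derivative (\<lambda>y. f y \<bullet> b) (at y) u) (at x)
      = frechet_derivative (\<lambda>y. frechet_derivative f (at y) u \<bullet> b) (at x)"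
      using d2 by (intro frechet_derivative_cong[OF \<open>open S\<close> \<open>x \<in> S\<close>])
        (simp_all add: frechet_derivative_linear_compose[OF bl d1] differentiable_compose
          bounded_linear_imp_differentiable[OF bl])
    then show ?thesis by (simp add: frechet_derivative_linear_compose[OF bl d2])
  qed
  moreover have "C_k_on 2 S (\<lambda>y. f y \<bullet> b)"
    using smooth_on_linear_compose[OF bl \<open>open S\<close> f] by (simp add: smooth_on_def)
  ultimately show "frechet_derivative (\<lambda>y. frechet_derivative f (at y) u) (at x) v \<bullet> b
       = frechet_derivative (\<lambda>y. frechet_derivative f (at y) v) (at x) u \<bullet> b"
    using second_derivative_symmetric_real[OF assms(1,2)] by metis
qed

text \<open>The product rule for \<open>df(Y)\<close>: one term differentiates the direction field,
  the other is the second derivative of \<open>f\<close> with the direction frozen at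
  \<open>Y x\<close>. In a commutator the second terms cancel by symmetry.\<close>

lemma frechet_derivative_deriv_along:
  fixes f :: "'a::euclidean_space \<Rightarrow> 'b::euclidean_space"
  assumes "open S" "x \<in> S" and f: "smooth_on S f" and Y: "smooth_on S Y"
  shows "frechet_derivative (deriv_along Y f) (at x) v
    = frechet_derivative f (at x) (frechet_derivative Y (at x) v)
      + frechet_derivative (\<lambda>y. frechet_derivative f (at y) (Y x)) (at x) v"
proof -
  note d = smooth_on_differentiable[OF f]
  have c: "((\<lambda>y. frechet_derivative f (at y) b) has_derivative
      frechet_derivative (\<lambda>y. frechet_derivative f (at y) b) (at x)) (at x)" for b
    by (rule smooth_on_has_derivative[OF smooth_on_frechet_derivative[OF f] \<open>x \<in> S\<close>])
  have "((\<lambda>y. \<Sum>b\<in>Basis. (Y y \<bullet> b) *\<^sub>R frechet_derivative f (at y) b) has_derivative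
     (\<lambda>v. \<Sum>b\<in>Basis. (Y x \<bullet> b) *\<^sub>R frechet_derivative (\<lambda>y. frechet_derivative f (at y) b) (at x) v
        + (frechet_derivative Y (at x) v \<bullet> b) *\<^sub>R frechet_derivative f (at x) b)) (at x)"
    using smooth_on_has_derivative[OF Y \<open>x \<in> S\<close>]
    by (intro has_derivative_sum has_derivative_scaleR c has_derivative_inner_left)
  then have "(deriv_along Y f has_derivative
     (\<lambda>v. \<Sum>b\<in>Basis. (Y x \<bullet> b) *\<^sub>R frechet_derivative (\<lambda>y. frechet_derivative f (at y) b) (at x) v
        + (frechet_derivative Y (at x) v \<bullet> b) *\<^sub>R frechet_derivative f (at x) b)) (at x)"
    by (rule has_derivative_transform_within_open[OF _ \<open>open S\<close> \<open>x \<in> S\<close>])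
      (simp add: deriv_along_def frechet_derivative_sum_Basis[OF d, symmetric])
  moreover have "frechet_derivative (\<lambda>y. frechet_derivative f (at y) (Y x)) (at x) =
    (\<lambda>v. \<Sum>b\<in>Basis. (Y x \<bullet> b) *\<^sub>R frechet_derivative (\<lambda>y. frechet_derivative f (at y) b) (at x) v)"
  proof (rule frechet_derivative_at[symmetric])
    have "((\<lambda>y. \<Sum>b\<in>Basis. (Y x \<bullet> b) *\<^sub>R frechet_derivative f (at y) b) has_derivative
     (\<lambda>v. \<Sum>b\<in>Basis. (Y x \<bullet> b) *\<^sub>R frechet_derivative (\<lambda>y. frechet_derivative f (at y) b) (at x) v)) (at x)"
      by (intro has_derivative_sum has_derivative_scaleR_right c)
    then show "((\<lambda>y. frechet_derivative f (at y) (Y x)) has_derivative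
     (\<lambda>v. \<Sum>b\<in>Basis. (Y x \<bullet> b) *\<^sub>R frechet_derivative (\<lambda>y. frechet_derivative f (at y) b) (at x) v)) (at x)"
      by (rule has_derivative_transform_within_open[OF _ \<open>open S\<close> \<open>x \<in> S\<close>])
        (simp add: frechet_derivative_sum_Basis[OF d, symmetric])
  qed
  ultimately show ?thesis
    by (simp add: frechet_derivative_at[symmetric] sum.distrib
        frechet_derivative_sum_Basis[OF d[OF \<open>x \<in> S\<close>], of "frechet_derivative Y (at x) v"])
qed

lemma deriv_along_lie_bracket:
  fixes f :: "'a::euclidean_space \<Rightarrow> 'b::euclidean_space"
  assumes "open S" "x \<in> S" and f: "smooth_on S f" and X: "smooth_on S X" and Y: "smooth_on S Y"
  shows "deriv_along (lie_bracket X Y) f x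
    = deriv_along X (deriv_along Y f) x - deriv_along Y (deriv_along X f) x"
proof -
  have l: "linear (frechet_derivative f (at x))"
    using linear_frechet_derivative[OF smooth_on_differentiable[OF f \<open>x \<in> S\<close>]] .
  have "deriv_along (lie_bracket X Y) f x = frechet_derivative f (at x) (frechet_derivative Y (at x) (X x))
     - frechet_derivative f (at x) (frechet_derivative X (at x) (Y x))"
    by (simp add: deriv_along_def[of _ f] lie_bracket_def linear_diff[OF l] deriv_along_def)
  also have "\<dots> = deriv_along X (deriv_along Y f) x - deriv_along Y (deriv_along X f) x"
    using second_derivative_symmetric[OF assms(1-3), of "Y x" "X x"]
      frechet_derivative_deriv_along[OF assms(1-3) Y, of "X x"]
      frechet_derivative_deriv_along[OF assms(1-3) X, of "Y x"]
    by (simp add: deriv_along_def[of X "deriv_along Y f"] deriv_along_def[of Y "deriv_along X f"])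
  finally show ?thesis .
qed

section \<open>Metrics and connections pulled back along a global chart\<close>

lemma frechet_derivative_inverse_apply:
  fixes f :: "'a::real_normed_vector \<Rightarrow> 'b::real_normed_vector" and g :: "'b \<Rightarrow> 'a"
  assumes "open S" "x \<in> S" "\<And>z. z \<in> S \<Longrightarrow> g (f z) = z"
    and "f differentiable (at x)" "g differentiable (at (f x))"
  shows "frechet_derivative g (at (f x)) (frechet_derivative f (at x) v) = v"
proof -
  have "frechet_derivative (\<lambda>z. z) (at x) = frechet_derivative (g \<circ> f) (at x)"
    by (rule frechet_derivative_transform_within_open[OF _ assms(1,2)]) (simp_all add: assms(3))
  also have "\<dots> = frechet_derivative g (at (f x)) \<circ> frechet_derivative f (at x)"
    by (rule frechet_derivative_compose[OF assms(4,5)])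
  finally show ?thesis by (metis comp_apply frechet_derivative_ident)
qed

text \<open>The chart is onto the whole of \<open>'b\<close>, because \<open>\<Phi>_E\<close> holds
  for every \<open>v\<close>: segments and limits never leave its image. The map \<open>A\<close>
  accounts for the difference between the ambient inner product and the one that defines the metric;
  its injectivity makes the metric definite.\<close>

locale flat_chart =
  fixes S :: "'a::euclidean_space set"
    and \<Phi> :: "'a \<Rightarrow> 'b::euclidean_space" and E :: "'b \<Rightarrow> 'a"
    and A :: "'b \<Rightarrow> 'c::euclidean_space"
  assumes open_S: "open S"
    and smooth_\<Phi>: "smooth_on S \<Phi>" and smooth_E: "smooth_on UNIV E"
    and E_in: "E v \<in> S" and \<Phi>_E: "\<Phi> (E v) = v" and E_\<Phi>: "x \<in> S \<Longrightarrow> E (\<Phi> x) = x"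
    and linear_A: "bounded_linear A" and inj_A: "inj A"
begin

definition pull_metric :: "'a \<Rightarrow> 'a \<Rightarrow> 'a \<Rightarrow> real" where
  "pull_metric x u v = A (frechet_derivative \<Phi> (at x) u) \<bullet> A (frechet_derivative \<Phi> (at x) v)"

definition nabla :: "('a \<Rightarrow> 'a) \<Rightarrow> ('a \<Rightarrow> 'a) \<Rightarrow> 'a \<Rightarrow> 'a" where
  "nabla U W = push_forward E \<Phi> (deriv_along (push_forward \<Phi> E U) (push_forward \<Phi> E W))"

lemmas diff_\<Phi> = smooth_on_differentiable[OF smooth_\<Phi>]
lemmas diff_E = smooth_on_differentiable[OF smooth_E UNIV_I]

lemma linear_d\<Phi>: "x \<in> S \<Longrightarrow> linear (frechet_derivative \<Phi> (at x))"
  by (rule linear_frechet_derivative[OF diff_\<Phi>])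

lemma dE_d\<Phi>: "x \<in> S \<Longrightarrow> frechet_derivative E (at (\<Phi> x)) (frechet_derivative \<Phi> (at x) v) = v"
  by (rule frechet_derivative_inverse_apply[OF open_S _ E_\<Phi> diff_\<Phi> diff_E])

lemma d\<Phi>_dE: "frechet_derivative \<Phi> (at (E y)) (frechet_derivative E (at y) w) = w"
  by (rule frechet_derivative_inverse_apply[OF open_UNIV UNIV_I \<Phi>_E diff_E diff_\<Phi>[OF E_in]])

lemma metric_deriv_along:
  "pull_metric x (Y x) (Z x) = A (deriv_along Y \<Phi> x) \<bullet> A (deriv_along Z \<Phi> x)"
  by (simp add: pull_metric_def deriv_along_def)

lemma metric_nondegenerate:
  assumes "x \<in> S" "pull_metric x u u = 0"
  shows "u = 0"
proof -
  have "A (frechet_derivative \<Phi> (at x) u) = A 0"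
    using assms(2) linear_A by (simp add: pull_metric_def linear_simps)
  then have "frechet_derivative \<Phi> (at x) u = 0" by (rule injD[OF inj_A])
  then show ?thesis
    using dE_d\<Phi>[OF assms(1), of u] linear_frechet_derivative[OF diff_E, of "\<Phi> x"] by (simp add: linear_0)
qed

text \<open>The field \<open>W\<close> has chart components \<open>deriv_along W \<Phi>\<close>, and
  its push-forward is this function composed with \<open>E\<close>. By the chain rule,
  differentiating along the push-forward of \<open>U\<close> in the chart is differentiating the
  components along \<open>U\<close> on \<open>S\<close>.\<close>

lemma nabla_eq:
  assumes "x \<in> S" and W: "smooth_on S W"
  shows "nabla U W x = frechet_derivative E (at (\<Phi> x)) (deriv_along U (deriv_along W \<Phi>) x)"
proof -
  have "push_forward \<Phi> E W = deriv_along W \<Phi> \<circ> E"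
    by (auto simp: push_forward_def deriv_along_def)
  moreover have "deriv_along W \<Phi> differentiable (at (E (\<Phi> x)))"
    using smooth_on_differentiable[OF smooth_on_deriv_along[OF open_S W smooth_\<Phi>] E_in] .
  ultimately have "frechet_derivative (push_forward \<Phi> E W) (at (\<Phi> x))
      = frechet_derivative (deriv_along W \<Phi>) (at x) \<circ> frechet_derivative E (at (\<Phi> x))"
    using assms(1) by (simp add: frechet_derivative_compose[OF diff_E] E_\<Phi>)
  moreover have "push_forward \<Phi> E U (\<Phi> x) = frechet_derivative \<Phi> (at x) (U x)"
    using assms(1) by (simp add: push_forward_def E_\<Phi>)
  ultimately show ?thesis
    using assms(1)
    by (simp add: nabla_def push_forward_def[of E] deriv_along_def[of "push_forward \<Phi> E U"]
        deriv_along_def[of U] dE_d\<Phi>)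
qed

lemma deriv_along_nabla:
  assumes "x \<in> S" "smooth_on S W"
  shows "deriv_along (nabla U W) \<Phi> x = deriv_along U (deriv_along W \<Phi>) x"
  using d\<Phi>_dE[of "\<Phi> x"] assms
  by (simp add: deriv_along_def[of "nabla U W"] nabla_eq E_\<Phi>)

text \<open>Since \<open>d\<Phi>\<close> is injective, every identity for the connection can be
  checked on chart components, where it is a statement about iterated derivatives of
  \<open>\<Phi>\<close>.\<close>

lemma nabla_eqI:
  assumes "x \<in> S" "smooth_on S W" "frechet_derivative \<Phi> (at x) v = deriv_along U (deriv_along W \<Phi>) x"
  shows "nabla U W x = v"
  using assms dE_d\<Phi>[of x v] by (simp add: nabla_eq)

lemma smooth_nabla:
  assumes U: "smooth_on S U" and W: "smooth_on S W"
  shows "smooth_on S (nabla U W)"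
proof (rule smooth_on_cong[OF open_S])
  show "smooth_on S (\<lambda>x. \<Sum>b\<in>Basis. (deriv_along U (deriv_along W \<Phi>) x \<bullet> b) *\<^sub>R
      frechet_derivative E (at (\<Phi> x)) b)"
    by (intro smooth_intros open_S smooth_on_deriv_along U W smooth_\<Phi>
        smooth_on_compose[OF smooth_on_frechet_derivative[OF smooth_E]]) auto
qed (simp add: nabla_eq[OF _ W] frechet_derivative_sum_Basis[OF diff_E, symmetric])

lemma deriv_along_add_fields:
  "f differentiable (at x) \<Longrightarrow> deriv_along (\<lambda>z. X z + Y z) f x = deriv_along X f x + deriv_along Y f x"
  by (simp add: deriv_along_def linear_add[OF linear_frechet_derivative])

lemma deriv_along_scale_field:
  "f differentiable (at x) \<Longrightarrow> deriv_along (\<lambda>z. h z *\<^sub>R X z) f x = h x *\<^sub>R deriv_along X f x"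
  by (simp add: deriv_along_def linear_scale[OF linear_frechet_derivative])

lemma affine_connection_nabla: "affine_connection S nabla"
proof
  fix X Y X' Y' :: "'a \<Rightarrow> 'a" and f :: "'a \<Rightarrow> real" and x
  note smooth_d = smooth_on_deriv_along[OF open_S _ smooth_\<Phi>]
  assume X: "smooth_on S X" and Y: "smooth_on S Y"
  show "smooth_on S (nabla X Y)" by (rule smooth_nabla[OF X Y])
  assume x: "x \<in> S"
  note diff_d = smooth_on_differentiable[OF smooth_d x]
  note simps = linear_add[OF linear_d\<Phi>[OF x]] linear_scale[OF linear_d\<Phi>[OF x]]
  {
    assume X': "smooth_on S X'"
    show "nabla (\<lambda>z. X z + X' z) Y x = nabla X Y x + nabla X' Y x"
      using x Y diff_d[OF Y] deriv_along_nabla[OF x Y]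
      by (intro nabla_eqI) (simp_all add: simps deriv_along_add_fields deriv_along_def[of "nabla _ _"])
  next
    assume f: "smooth_on S f"
    show "nabla (\<lambda>z. f z *\<^sub>R X z) Y x = f x *\<^sub>R nabla X Y x"
      using x Y diff_d[OF Y] deriv_along_nabla[OF x Y]
      by (intro nabla_eqI) (simp_all add: simps deriv_along_scale_field deriv_along_def[of "nabla _ _"])
    \<comment> \<open>On \<open>S\<close> the components of \<open>f Y\<close> are \<open>f\<close>
      times those of \<open>Y\<close>, by linearity of \<open>d\<Phi>\<close>; the ordinary product
      rule then produces the Leibniz term.\<close>
    have "frechet_derivative (deriv_along (\<lambda>z. f z *\<^sub>R Y z) \<Phi>) (at x)
      = frechet_derivative (\<lambda>z. f z *\<^sub>R deriv_along Y \<Phi> z) (at x)"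
      using diff_d[OF smooth_on_scaleR[OF open_S f Y]]
      by (rule frechet_derivative_transform_within_open[OF _ open_S x])
        (simp add: deriv_along_scale_field diff_\<Phi>)
    also have "\<dots> = (\<lambda>v. f x *\<^sub>R frechet_derivative (deriv_along Y \<Phi>) (at x) v
        + frechet_derivative f (at x) v *\<^sub>R deriv_along Y \<Phi> x)"
      by (rule frechet_derivative_at[symmetric])
        (intro has_derivative_scaleR smooth_on_has_derivative[OF f x]
          smooth_on_has_derivative[OF smooth_d[OF Y] x])
    finally show "nabla X (\<lambda>z. f z *\<^sub>R Y z) x = deriv_along X f x *\<^sub>R Y x + f x *\<^sub>R nabla X Y x"
      using x f Y deriv_along_nabla[OF x Y, of X]
      by (intro nabla_eqI smooth_intros open_S) (simp_all add: simps deriv_along_def)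
  next
    assume Y': "smooth_on S Y'"
    have "frechet_derivative (deriv_along (\<lambda>z. Y z + Y' z) \<Phi>) (at x)
      = frechet_derivative (\<lambda>z. deriv_along Y \<Phi> z + deriv_along Y' \<Phi> z) (at x)"
      using diff_d[OF smooth_on_add[OF open_S Y Y']]
      by (rule frechet_derivative_transform_within_open[OF _ open_S x])
        (simp add: deriv_along_add_fields diff_\<Phi>)
    also have "\<dots> = (\<lambda>v. frechet_derivative (deriv_along Y \<Phi>) (at x) v
        + frechet_derivative (deriv_along Y' \<Phi>) (at x) v)"
      by (rule frechet_derivative_at[symmetric])
        (intro has_derivative_add smooth_on_has_derivative[OF smooth_d[OF Y] x]
          smooth_on_has_derivative[OF smooth_d[OF Y'] x])
    finally show "nabla X (\<lambda>z. Y z + Y' z) x = nabla X Y x + nabla X Y' x"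
      using x Y Y' deriv_along_nabla[OF x Y, of X] deriv_along_nabla[OF x Y', of X]
      by (intro nabla_eqI smooth_intros open_S) (simp_all add: simps deriv_along_def)
  }
qed

lemma torsion_free_nabla: "torsion_free S nabla"
  unfolding torsion_free_def
proof (intro allI impI ballI)
  fix X Y :: "'a \<Rightarrow> 'a" and x assume X: "smooth_on S X" and Y: "smooth_on S Y" and x: "x \<in> S"
  have "nabla X Y x = nabla Y X x + lie_bracket X Y x"
    using deriv_along_lie_bracket[OF open_S x smooth_\<Phi> X Y] deriv_along_nabla[OF x X, of Y]
    by (intro nabla_eqI[OF x Y]) (simp add: linear_add[OF linear_d\<Phi>[OF x]] deriv_along_def)
  then show "nabla X Y x - nabla Y X x = lie_bracket X Y x" by simp
qed

lemma deriv_along_cong: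
  assumes "x \<in> S" "smooth_on S f" "\<And>y. y \<in> S \<Longrightarrow> f y = g y"
  shows "deriv_along X g x = deriv_along X f x"
  using frechet_derivative_cong[OF open_S assms(1) smooth_on_differentiable[OF assms(2,1)] assms(3)]
  by (simp add: deriv_along_def)

lemma flat_nabla: "flat S nabla"
  unfolding flat_def
proof (intro allI impI ballI)
  fix X Y Z :: "'a \<Rightarrow> 'a" and x
  assume X: "smooth_on S X" and Y: "smooth_on S Y" and Z: "smooth_on S Z" and x: "x \<in> S"
  let ?Z = "deriv_along Z \<Phi>"
  \<comment> \<open>Torsion applies the commutator identity to \<open>\<Phi>\<close> itself;
    curvature applies it to the components of \<open>Z\<close>.\<close>
  have Z': "smooth_on S ?Z" by (rule smooth_on_deriv_along[OF open_S Z smooth_\<Phi>])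
  have *: "deriv_along (nabla X (nabla Y Z)) \<Phi> x = deriv_along X (deriv_along Y ?Z) x"
    if Y: "smooth_on S Y" for X Y
    by (subst deriv_along_nabla[OF x smooth_nabla[OF Y Z]],
      rule deriv_along_cong[OF x smooth_on_deriv_along[OF open_S Y Z'] deriv_along_nabla[OF _ Z, symmetric]])
  have "nabla (lie_bracket X Y) Z x = nabla X (nabla Y Z) x - nabla Y (nabla X Z) x"
    using *[OF Y, of X] *[OF X, of Y] deriv_along_lie_bracket[OF open_S x Z' X Y]
    by (intro nabla_eqI[OF x Z]) (simp add: linear_diff[OF linear_d\<Phi>[OF x]] deriv_along_def[of _ \<Phi>])
  then show "nabla X (nabla Y Z) x - nabla Y (nabla X Z) x - nabla (lie_bracket X Y) Z x = 0" by simp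
qed

text \<open>The metric of two fields is the Euclidean inner product of their components under
  \<open>A\<close>, so compatibility is the product rule for that inner product.\<close>

lemma metric_compatible_nabla: "metric_compatible S pull_metric nabla"
  unfolding metric_compatible_def
proof (intro allI impI ballI)
  fix X Y Z :: "'a \<Rightarrow> 'a" and x
  assume X: "smooth_on S X" and Y: "smooth_on S Y" and Z: "smooth_on S Z" and x: "x \<in> S"
  have d: "((\<lambda>z. A (deriv_along Y \<Phi> z)) has_derivative
      (\<lambda>v. A (frechet_derivative (deriv_along Y \<Phi>) (at x) v))) (at x)" if Y: "smooth_on S Y" for Y
    by (rule bounded_linear.has_derivative[OF linear_A
        smooth_on_has_derivative[OF smooth_on_deriv_along[OF open_S Y smooth_\<Phi>] x]])
  show "deriv_along X (\<lambda>z. pull_metric z (Y z) (Z z)) x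
      = pull_metric x (nabla X Y x) (Z x) + pull_metric x (Y x) (nabla X Z x)"
    unfolding metric_deriv_along metric_deriv_along[of x "nabla X Y"] metric_deriv_along[of x Y "nabla X Z"]
      deriv_along_nabla[OF x Y] deriv_along_nabla[OF x Z]
    by (simp add: deriv_along_def[of X] frechet_derivative_at[OF has_derivative_inner[OF d[OF Y] d[OF Z]], symmetric])
qed

lemma metric_bilinear:
  assumes "x \<in> S"
  shows "pull_metric x (u - u') v = pull_metric x u v - pull_metric x u' v" "pull_metric x u v = pull_metric x v u"
  using linear_A by (simp_all add: pull_metric_def linear_diff[OF linear_d\<Phi>[OF assms]] linear_simps
      inner_diff_left, simp add: inner_commute)

text \<open>For two such connections, \<open>g (D' X Y - D X Y) Z\<close> is symmetric in \<open>X, Y\<close>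
  and antisymmetric in \<open>Y, Z\<close>, hence zero.\<close>

lemma levi_civita_unique:
  assumes D: "torsion_free S D" "metric_compatible S pull_metric D"
    and D': "torsion_free S D'" "metric_compatible S pull_metric D'"
    and X: "smooth_on S X" and Y: "smooth_on S Y" and x: "x \<in> S"
  shows "D' X Y x = D X Y x"
proof -
  let ?t = "\<lambda>X Y Z. pull_metric x (D' X Y x - D X Y x) (Z x)"
  have sym: "?t X Y Z = ?t Y X Z" if "smooth_on S X" "smooth_on S Y" for X Y Z
  proof -
    have "D' X Y x - D' Y X x = D X Y x - D Y X x"
      using D(1) D'(1) that x by (simp add: torsion_free_def)
    then have "D' X Y x - D X Y x = D' Y X x - D Y X x" by (simp add: algebra_simps)
    then show ?thesis by simp
  qed
  have anti: "?t X Y Z = - ?t X Z Y" if "smooth_on S X" "smooth_on S Y" "smooth_on S Z" for X Y Z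
  proof -
    have "pull_metric x (D' X Y x) (Z x) + pull_metric x (Y x) (D' X Z x)
        = pull_metric x (D X Y x) (Z x) + pull_metric x (Y x) (D X Z x)"
      using D(2)[unfolded metric_compatible_def, rule_format, OF that x]
        D'(2)[unfolded metric_compatible_def, rule_format, OF that x] by linarith
    then show ?thesis
      using metric_bilinear(2)[OF x, of "Y x" "D' X Z x"] metric_bilinear(2)[OF x, of "Y x" "D X Z x"]
      by (simp add: metric_bilinear(1)[OF x])
  qed
  \<comment> \<open>A constant field extends the difference vector smoothly. Alternating the two
    symmetries through all six orders of the arguments returns \<open>?t X Y Z\<close> with the
    opposite sign, and for this \<open>Z\<close> the value is the square of the difference.\<close>
  define Z :: "'a \<Rightarrow> 'a" where "Z = (\<lambda>_. D' X Y x - D X Y x)"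
  have Z: "smooth_on S Z" unfolding Z_def by (rule smooth_on_const)
  have "?t X Y Z = 0"
    using anti[OF X Y Z] sym[OF X Z, of Y] anti[OF Z X Y] sym[OF Z Y, of X] anti[OF Y Z X] sym[OF Y X, of Z]
    by linarith
  then show ?thesis using metric_nondegenerate[OF x, of "D' X Y x - D X Y x"] by (simp add: Z_def)
qed

lemma is_levi_civita_nabla: "is_levi_civita S pull_metric nabla"
  unfolding is_levi_civita_def
  using affine_connection_nabla torsion_free_nabla metric_compatible_nabla levi_civita_unique by blast

section \<open>Curve length, distance and completeness\<close>

lemma speed_eq: "sqrt (pull_metric x u u) = norm (A (frechet_derivative \<Phi> (at x) u))"
  by (simp add: pull_metric_def norm_eq_sqrt_inner)

text \<open>The speed is the norm of the derivative of \<open>A (\<Phi> (\<gamma> t))\<close>; the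
  bound is the fundamental theorem of calculus followed by norm of integral \<le> integral of
  norm.\<close>

lemma piece_length:
  fixes \<gamma> :: "real \<Rightarrow> 'a"
  assumes "a < b" and \<gamma>': "continuous_on {a..b} \<gamma>'" and inS: "\<gamma> ` {a..b} \<subseteq> S"
    and deriv: "\<And>t. t \<in> {a..b} \<Longrightarrow> (\<gamma> has_vector_derivative \<gamma>' t) (at t within {a..b})"
  defines "v \<equiv> \<lambda>t. sqrt (pull_metric (\<gamma> t) (vector_derivative \<gamma> (at t)) (vector_derivative \<gamma> (at t)))"
  shows "v integrable_on {a..b}"
    and "norm (A (\<Phi> (\<gamma> b)) - A (\<Phi> (\<gamma> a))) \<le> integral {a..b} v"
proof -
  define w where "w t = A (frechet_derivative \<Phi> (at (\<gamma> t)) (\<gamma>' t))" for t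
  have \<gamma>: "continuous_on {a..b} \<gamma>"
    by (meson deriv continuous_on_eq_continuous_within has_vector_derivative_continuous)
  have "continuous_on {a..b} (\<lambda>t. \<Sum>c\<in>Basis. (\<gamma>' t \<bullet> c) *\<^sub>R frechet_derivative \<Phi> (at (\<gamma> t)) c)"
    using smooth_on_continuous_on[OF smooth_on_frechet_derivative[OF smooth_\<Phi>]] inS
    by (intro continuous_intros \<gamma>' continuous_on_compose2[OF _ \<gamma>]) auto
  moreover have "(\<Sum>c\<in>Basis. (\<gamma>' t \<bullet> c) *\<^sub>R frechet_derivative \<Phi> (at (\<gamma> t)) c)
      = frechet_derivative \<Phi> (at (\<gamma> t)) (\<gamma>' t)" if "t \<in> {a..b}" for t
    using inS that by (subst (2) frechet_derivative_sum_Basis) (auto intro!: diff_\<Phi>)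
  ultimately have "continuous_on {a..b} (\<lambda>t. frechet_derivative \<Phi> (at (\<gamma> t)) (\<gamma>' t))"
    by (rule continuous_on_eq)
  then have w: "continuous_on {a..b} w"
    unfolding w_def by (rule bounded_linear.continuous_on[OF linear_A])
  \<comment> \<open>At the ends of a piece only a one-sided derivative is given, so the two-sided
    \<open>vector_derivative\<close> in the length is not controlled there. The two points are
    discarded as a finite set.\<close>
  have v_eq: "v t = norm (w t)" if "t \<in> {a..b} - {a, b}" for t
  proof -
    have "(\<gamma> has_vector_derivative \<gamma>' t) (at t)"
      using deriv[of t] that at_within_Icc_at[of a t b] by auto
    then show ?thesis by (simp add: v_def w_def speed_eq vector_derivative_at)
  qed
  have nw: "((\<lambda>t. norm (w t)) has_integral integral {a..b} (\<lambda>t. norm (w t))) {a..b}"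
    by (intro integrable_integral integrable_continuous_interval continuous_intros w)
  have v: "(v has_integral integral {a..b} (\<lambda>t. norm (w t))) {a..b}"
    by (rule has_integral_spike_finite[of "{a, b}" "{a..b}", OF _ v_eq nw]) auto
  then show "v integrable_on {a..b}" by blast
  have "((\<lambda>t. A (\<Phi> (\<gamma> t))) has_vector_derivative w t) (at t within {a..b})" if t: "t \<in> {a..b}" for t
  proof -
    have "((\<lambda>x. A (\<Phi> x)) has_derivative (\<lambda>u. A (frechet_derivative \<Phi> (at (\<gamma> t)) u))) (at (\<gamma> t))"
      using inS t
      by (intro bounded_linear.has_derivative[OF linear_A] smooth_on_has_derivative[OF smooth_\<Phi>]) auto
    from has_derivative_compose[OF deriv[OF t, unfolded has_vector_derivative_def] this] show ?thesis
      using inS t linear_A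
      by (auto simp: has_vector_derivative_def w_def linear_scale[OF linear_d\<Phi>] linear_simps image_subset_iff)
  qed
  from fundamental_theorem_of_calculus[OF less_imp_le[OF \<open>a < b\<close>] this]
  have "(w has_integral A (\<Phi> (\<gamma> b)) - A (\<Phi> (\<gamma> a))) {a..b}" by simp
  then have "norm (A (\<Phi> (\<gamma> b)) - A (\<Phi> (\<gamma> a))) \<le> integral {a..b} (\<lambda>t. norm (w t))"
    using nw integral_norm_bound_integral[of w "{a..b}" "\<lambda>t. norm (w t)"]
    by (auto simp: has_integral_iff)
  then show "norm (A (\<Phi> (\<gamma> b)) - A (\<Phi> (\<gamma> a))) \<le> integral {a..b} v"
    using v by (simp add: has_integral_iff)
qed

text \<open>The triangle inequality adds up the pieces. Integrability is carried along in the
  induction, because splitting an integral at a break point requires it.\<close>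

lemma curve_length_ge:
  assumes "piecewise_C1_curve \<gamma>" and inS: "\<gamma> ` {0..1} \<subseteq> S"
  shows "norm (A (\<Phi> (\<gamma> 1)) - A (\<Phi> (\<gamma> 0))) \<le> curve_length pull_metric \<gamma>"
proof -
  let ?v = "\<lambda>t. sqrt (pull_metric (\<gamma> t) (vector_derivative \<gamma> (at t)) (vector_derivative \<gamma> (at t)))"
  obtain n and p :: "nat \<Rightarrow> real" where p: "p 0 = 0" "p n = 1"
    "\<And>i. i < n \<Longrightarrow> p i < p (Suc i)"
    and pieces: "\<And>i. i < n \<Longrightarrow> \<exists>\<gamma>'. continuous_on {p i..p (Suc i)} \<gamma>' \<and>
       (\<forall>t\<in>{p i..p (Suc i)}. (\<gamma> has_vector_derivative \<gamma>' t) (at t within {p i..p (Suc i)}))"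
    using assms(1) unfolding piecewise_C1_curve_def by metis
  have mono: "p i \<le> p j" if "i \<le> j" "j \<le> n" for i j
    using that by (induction j) (auto simp: le_Suc_eq intro: order_trans[OF _ less_imp_le[OF p(3)]])
  have "k \<le> n \<Longrightarrow> ?v integrable_on {0..p k} \<and>
      norm (A (\<Phi> (\<gamma> (p k))) - A (\<Phi> (\<gamma> 0))) \<le> integral {0..p k} ?v" for k
  proof (induction k)
    case 0
    show ?case using integrable_on_refl[of ?v 0] by (simp add: p(1))
  next
    case (Suc k)
    then have k: "k < n" by simp
    have le: "0 \<le> p k" "p k \<le> p (Suc k)" "p (Suc k) \<le> 1"
      using mono[of 0 k] mono[of k "Suc k"] mono[of "Suc k" n] k p by auto
    obtain \<gamma>' where \<gamma>': "continuous_on {p k..p (Suc k)} \<gamma>'"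
      "\<And>t. t \<in> {p k..p (Suc k)} \<Longrightarrow> (\<gamma> has_vector_derivative \<gamma>' t) (at t within {p k..p (Suc k)})"
      using pieces[OF k] by blast
    have "\<gamma> ` {p k..p (Suc k)} \<subseteq> S" using inS le by (auto simp: image_subset_iff)
    note piece = piece_length[OF p(3)[OF k] \<gamma>'(1) this \<gamma>'(2)]
    have int: "?v integrable_on {0..p (Suc k)}"
      using Henstock_Kurzweil_Integration.integrable_combine[OF le(1,2)] Suc k piece(1) by auto
    have "norm (A (\<Phi> (\<gamma> (p (Suc k)))) - A (\<Phi> (\<gamma> 0))) \<le> integral {0..p k} ?v + integral {p k..p (Suc k)} ?v"
      using Suc k piece(2) norm_triangle_ineq[of "A (\<Phi> (\<gamma> (p (Suc k)))) - A (\<Phi> (\<gamma> (p k)))"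
          "A (\<Phi> (\<gamma> (p k))) - A (\<Phi> (\<gamma> 0))"] by simp
    then show ?case using int Henstock_Kurzweil_Integration.integral_combine[OF le(1,2) int] by simp
  qed
  from this[of n] show ?thesis by (simp add: p curve_length_def)
qed

lemma straight_curve:
  fixes u v :: 'b
  defines "\<gamma> \<equiv> \<lambda>t. E (u + t *\<^sub>R (v - u))"
  shows "piecewise_C1_curve \<gamma>" "curve_length pull_metric \<gamma> = norm (A v - A u)"
proof -
  let ?\<gamma>' = "\<lambda>t. frechet_derivative E (at (u + t *\<^sub>R (v - u))) (v - u)"
  have deriv: "(\<gamma> has_vector_derivative ?\<gamma>' t) (at t)" for t
  proof -
    have "((\<lambda>t. u + t *\<^sub>R (v - u)) has_derivative (\<lambda>t. t *\<^sub>R (v - u))) (at t)"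
      by (auto intro!: derivative_eq_intros)
    from has_derivative_compose[OF this smooth_on_has_derivative[OF smooth_E UNIV_I]] show ?thesis
      by (simp add: \<gamma>_def has_vector_derivative_def linear_scale[OF linear_frechet_derivative[OF diff_E]])
  qed
  have "continuous_on {0..1} ?\<gamma>'"
    using smooth_on_continuous_on[OF smooth_on_frechet_derivative[OF smooth_E, of "v - u"]]
    by (rule continuous_on_compose2) (auto intro!: continuous_intros)
  then have "\<exists>\<gamma>'. continuous_on {0..1} \<gamma>' \<and>
      (\<forall>t\<in>{0..1}. (\<gamma> has_vector_derivative \<gamma>' t) (at t within {0..1}))"
    using has_vector_derivative_at_within[OF deriv] by blast
  then show "piecewise_C1_curve \<gamma>"
    \<comment> \<open>A single piece suffices: \<open>real\<close> as the sequence of break points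
      takes the values 0 and 1.\<close>
    unfolding piecewise_C1_curve_def by (intro exI[of _ "1::nat"] exI[of _ real]) simp
  have "frechet_derivative \<Phi> (at (\<gamma> t)) (vector_derivative \<gamma> (at t)) = v - u" for t
    by (subst vector_derivative_at[OF deriv]) (simp add: \<gamma>_def d\<Phi>_dE)
  then show "curve_length pull_metric \<gamma> = norm (A v - A u)"
    using linear_A by (simp add: curve_length_def speed_eq linear_simps)
qed

lemma riemannian_distance_eq:
  assumes "x \<in> S" "y \<in> S"
  shows "riemannian_distance S pull_metric x y = norm (A (\<Phi> x) - A (\<Phi> y))"
proof -
  let ?C = "{\<gamma>. piecewise_C1_curve \<gamma> \<and> \<gamma> ` {0..1} \<subseteq> S \<and> \<gamma> 0 = x \<and> \<gamma> 1 = y}"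
  let ?\<gamma> = "\<lambda>t. E (\<Phi> x + t *\<^sub>R (\<Phi> y - \<Phi> x))"
  have "?\<gamma> \<in> ?C" using straight_curve(1) assms E_in E_\<Phi> by auto
  then have "norm (A (\<Phi> y) - A (\<Phi> x)) \<in> curve_length pull_metric ` ?C"
    using straight_curve(2)[of "\<Phi> x" "\<Phi> y"] by (metis (no_types, lifting) image_eqI)
  moreover have "norm (A (\<Phi> y) - A (\<Phi> x)) \<le> l" if "l \<in> curve_length pull_metric ` ?C" for l
    using that curve_length_ge by auto
  ultimately show ?thesis
    using assms by (simp add: riemannian_distance_def cInf_eq_minimum norm_minus_commute)
qed

text \<open>Nonnegativity and symmetry are asked of all points, hence the case split against the
  default value 0 off \<open>S\<close>. Definiteness rests on injectivity of \<open>A\<close> and of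
  the chart.\<close>

lemma metric_space_riemannian_distance: "Metric_space S (riemannian_distance S pull_metric)"
proof
  fix x y z
  show "0 \<le> riemannian_distance S pull_metric x y"
    using riemannian_distance_eq[of x y] by (cases "x \<in> S \<and> y \<in> S") (auto simp: riemannian_distance_def)
  show "riemannian_distance S pull_metric x y = riemannian_distance S pull_metric y x"
    using riemannian_distance_eq[of x y] riemannian_distance_eq[of y x]
    by (cases "x \<in> S \<and> y \<in> S") (auto simp: riemannian_distance_def norm_minus_commute)
  assume xy: "x \<in> S" "y \<in> S"
  then show "riemannian_distance S pull_metric x y = 0 \<longleftrightarrow> x = y"
    using E_\<Phi> injD[OF inj_A, of "\<Phi> x" "\<Phi> y"] by (auto simp: riemannian_distance_eq) metis
  assume "z \<in> S"
  with xy show "riemannian_distance S pull_metric x z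
      \<le> riemannian_distance S pull_metric x y + riemannian_distance S pull_metric y z"
    using norm_triangle_ineq[of "A (\<Phi> x) - A (\<Phi> y)" "A (\<Phi> y) - A (\<Phi> z)"] by (simp add: riemannian_distance_eq)
qed

lemma riemannian_complete: "riemannian_complete S pull_metric"
proof -
  interpret M: Metric_space S "riemannian_distance S pull_metric"
    by (rule metric_space_riemannian_distance)
  \<comment> \<open>An injective linear map in finite dimension is bounded below. Cauchy sequences
    for the distance are therefore Cauchy in the chart, with tolerance \<open>B * e\<close> to
    absorb the factor.\<close>
  obtain B where B: "B > 0" "\<And>x. B * norm x \<le> norm (A x)"
    using linear_inj_bounded_below_pos[OF bounded_linear.linear[OF linear_A] inj_A] by blast
  have "\<exists>x. limitin M.mtopology \<sigma> x sequentially" if \<sigma>: "M.MCauchy \<sigma>" for \<sigma>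
  proof -
    have S: "\<sigma> n \<in> S" for n using \<sigma> by (auto simp: M.MCauchy_def)
    have "Cauchy (\<lambda>n. \<Phi> (\<sigma> n))"
    proof (rule metric_CauchyI)
      fix e :: real assume "0 < e"
      then obtain N where N: "\<And>m n. N \<le> m \<Longrightarrow> N \<le> n \<Longrightarrow> riemannian_distance S pull_metric (\<sigma> m) (\<sigma> n) < B * e"
        using \<sigma> \<open>B > 0\<close> unfolding M.MCauchy_def by (meson mult_pos_pos)
      have "dist (\<Phi> (\<sigma> m)) (\<Phi> (\<sigma> n)) < e" if "N \<le> m" "N \<le> n" for m n
      proof -
        have "B * dist (\<Phi> (\<sigma> m)) (\<Phi> (\<sigma> n)) < B * e"
          using B(2)[of "\<Phi> (\<sigma> m) - \<Phi> (\<sigma> n)"] N[OF that] S linear_A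
          by (simp add: riemannian_distance_eq dist_norm linear_simps)
        then show ?thesis using \<open>B > 0\<close> by simp
      qed
      then show "\<exists>M. \<forall>m\<ge>M. \<forall>n\<ge>M. dist (\<Phi> (\<sigma> m)) (\<Phi> (\<sigma> n)) < e" by blast
    qed
    then obtain v where "(\<lambda>n. \<Phi> (\<sigma> n)) \<longlonglongrightarrow> v" using Cauchy_convergent convergent_def by blast
    then have "(\<lambda>n. A (\<Phi> (\<sigma> n))) \<longlonglongrightarrow> A v" by (rule bounded_linear.tendsto[OF linear_A])
    then have "(\<lambda>n. dist (A (\<Phi> (\<sigma> n))) (A v)) \<longlonglongrightarrow> 0" by (rule tendsto_dist_iff[THEN iffD1])
    then have "(\<lambda>n. riemannian_distance S pull_metric (\<sigma> n) (E v)) \<longlonglongrightarrow> 0"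
      using S by (simp add: riemannian_distance_eq E_in \<Phi>_E dist_norm)
    then have "limitin M.mtopology \<sigma> (E v) sequentially"
      using S E_in unfolding M.limitin_metric by (auto simp: order_tendsto_iff)
    then show ?thesis by blast
  qed
  then show ?thesis
    unfolding riemannian_complete_def M.mcomplete_def using metric_space_riemannian_distance by blast
qed

end

section \<open>The matrix exponential and its injectivity\<close>

lemma bounded_bilinear_matrix_mult:
  "bounded_bilinear ((**) :: real^'n^'m \<Rightarrow> real^'k^'n \<Rightarrow> real^'k^'m)"
  unfolding bilinear_conv_bounded_bilinear[symmetric]
  by (auto simp: bilinear_def linear_iff vec_eq_iff matrix_matrix_mult_def sum.distrib
      sum_distrib_left algebra_simps)

interpretation matrix_mult: bounded_bilinear "(**) :: real^3^3 \<Rightarrow> real^3^3 \<Rightarrow> real^3^3"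
  by (rule bounded_bilinear_matrix_mult)

lemma has_vector_derivative_entries:
  fixes M :: "real \<Rightarrow> real^'n^'m"
  assumes "\<And>i j. ((\<lambda>t. M t $ i $ j) has_real_derivative M' $ i $ j) (at t)"
  shows "(M has_vector_derivative M') (at t)"
  unfolding has_vector_derivative_def has_derivative_componentwise_within[of M]
  by (auto simp: Basis_vec_def inner_axis fun_eq_iff
      intro!: has_derivative_eq_rhs[OF assms[unfolded has_field_derivative_def]])

lemma has_vector_derivative_entry:
  fixes M :: "real \<Rightarrow> real^'n^'m"
  assumes "(M has_vector_derivative M') (at t)"
  shows "((\<lambda>t. M t $ i $ j) has_real_derivative M' $ i $ j) (at t)"
  using bounded_linear.has_vector_derivative[OF bounded_linear_compose[OF bounded_linear_vec_nth[of j]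
      bounded_linear_vec_nth[of i]] assms] has_real_derivative_iff_has_vector_derivative by blast

abbreviation matrix_power :: "real^3^3 \<Rightarrow> nat \<Rightarrow> real^3^3" where
  "matrix_power A n \<equiv> (((**) A) ^^ n) (mat 1)"

lemma matrix_power_commute: "A ** matrix_power A n = matrix_power A n ** A"
proof (induction n)
  case (Suc n)
  have "A ** (A ** matrix_power A n) = A ** (matrix_power A n ** A)" using Suc by simp
  then show ?case by (simp add: matrix_mul_assoc)
qed simp

lemma matrix_power_scaleR: "matrix_power (t *\<^sub>R A) n = t ^ n *\<^sub>R matrix_power A n"
  by (induction n) (simp_all add: matrix_mult.scaleR_left matrix_mult.scaleR_right)

text \<open>The sum of the absolute values of all entries serves as a crude submultiplicative bound,
  so the scalar exponential series dominates every entry.\<close>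

lemma matrix_power_entry_le:
  "\<bar>matrix_power A n $ i $ j\<bar> \<le> (\<Sum>i\<in>UNIV. \<Sum>k\<in>UNIV. \<bar>A $ i $ k\<bar>) ^ n"
proof (induction n arbitrary: i j)
  case 0
  show ?case by (simp add: mat_def)
next
  case (Suc n)
  let ?c = "\<Sum>i\<in>UNIV. \<Sum>k\<in>UNIV. \<bar>A $ i $ k\<bar>"
  have "\<bar>matrix_power A (Suc n) $ i $ j\<bar> \<le> (\<Sum>k\<in>UNIV. \<bar>A $ i $ k\<bar> * \<bar>matrix_power A n $ k $ j\<bar>)"
    using sum_abs[of "\<lambda>k. A $ i $ k * matrix_power A n $ k $ j" UNIV]
    by (simp add: matrix_matrix_mult_def abs_mult)
  also have "\<dots> \<le> (\<Sum>k\<in>UNIV. \<bar>A $ i $ k\<bar>) * ?c ^ n"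
    unfolding sum_distrib_right by (intro sum_mono mult_left_mono Suc.IH) auto
  also have "\<dots> \<le> ?c * ?c ^ n"
    by (intro mult_right_mono member_le_sum[of i UNIV "\<lambda>i. \<Sum>k\<in>UNIV. \<bar>A $ i $ k\<bar>"]
        zero_le_power sum_nonneg) auto
  finally show ?case by simp
qed

lemma summable_matrix_exp: "summable (\<lambda>n. matrix_power A n $ i $ j / fact n * t ^ n)"
proof (rule summable_comparison_test')
  let ?c = "\<Sum>i\<in>UNIV. \<Sum>k\<in>UNIV. \<bar>A $ i $ k\<bar>"
  show "summable (\<lambda>n. inverse (fact n) * (?c * \<bar>t\<bar>) ^ n)" by (rule summable_exp)
  show "norm (matrix_power A n $ i $ j / fact n * t ^ n) \<le> inverse (fact n) * (?c * \<bar>t\<bar>) ^ n" for n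
    using mult_right_mono[OF matrix_power_entry_le[where A = A and n = n and i = i and j = j], of "\<bar>t\<bar> ^ n / fact n"]
    by (simp add: abs_mult power_abs power_mult_distrib field_simps)
qed

lemma matrix_exp_entry_sums:
  "(\<lambda>n. matrix_power A n $ i $ j / fact n) sums (matrix_exp A $ i $ j)"
proof -
  let ?e = "\<lambda>i j. \<Sum>n. matrix_power A n $ i $ j / fact n"
  have "(\<lambda>n. matrix_power A n $ i $ j / fact n) sums ?e i j" for i j
    using summable_matrix_exp[of A i j 1] by (simp add: summable_sums)
  then have *: "(\<lambda>n. (1 / fact n) *\<^sub>R matrix_power A n) sums (\<chi> i j. ?e i j)"
    unfolding sums_def by (intro vec_tendstoI) (simp add: sum_component)
  show ?thesis
    using \<open>(\<lambda>n. matrix_power A n $ i $ j / fact n) sums ?e i j\<close> sums_unique[OF *, symmetric]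
    by (simp add: matrix_exp_def)
qed

lemma matrix_exp_scaleR_entry:
  "matrix_exp (t *\<^sub>R A) $ i $ j = (\<Sum>n. matrix_power A n $ i $ j / fact n * t ^ n)"
  using sums_unique[OF matrix_exp_entry_sums[of "t *\<^sub>R A" i j]]
  by (simp add: matrix_power_scaleR mult.commute)

lemma has_vector_derivative_matrix_exp:
  "((\<lambda>t. matrix_exp (t *\<^sub>R A)) has_vector_derivative A ** matrix_exp (t *\<^sub>R A)) (at t)"
proof (rule has_vector_derivative_entries)
  fix i j
  have "diffs (\<lambda>n. matrix_power A n $ i $ j / fact n) n * t ^ n
      = (\<Sum>k\<in>UNIV. A $ i $ k * (matrix_power A n $ k $ j / fact n * t ^ n))" for n
  proof -
    have "diffs (\<lambda>n. matrix_power A n $ i $ j / fact n) n = matrix_power A (Suc n) $ i $ j / fact n"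
      by (simp add: diffs_def del: of_nat_Suc)
    then show ?thesis
      by (simp add: matrix_matrix_mult_def sum_divide_distrib sum_distrib_right mult.assoc)
  qed
  moreover have "(\<lambda>n. \<Sum>k\<in>UNIV. A $ i $ k * (matrix_power A n $ k $ j / fact n * t ^ n))
      sums (\<Sum>k\<in>UNIV. A $ i $ k * matrix_exp (t *\<^sub>R A) $ k $ j)"
    unfolding matrix_exp_scaleR_entry
    by (intro sums_sum sums_mult summable_sums summable_matrix_exp)
  ultimately have "(\<Sum>n. diffs (\<lambda>n. matrix_power A n $ i $ j / fact n) n * t ^ n)
      = (A ** matrix_exp (t *\<^sub>R A)) $ i $ j"
    by (simp add: sums_iff matrix_matrix_mult_def)
  then show "((\<lambda>t. matrix_exp (t *\<^sub>R A) $ i $ j) has_real_derivative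
      (A ** matrix_exp (t *\<^sub>R A)) $ i $ j) (at t)"
    unfolding matrix_exp_scaleR_entry
    using termdiffs_strong_converges_everywhere[OF summable_matrix_exp[of A i j], of t] by simp
qed

lemma matrix_exp_commute: "A ** matrix_exp A = matrix_exp A ** A"
proof -
  have "(A ** matrix_exp A) $ i $ j = (matrix_exp A ** A) $ i $ j" for i j
  proof (rule sums_unique2)
    have "(\<lambda>n. \<Sum>k\<in>UNIV. A $ i $ k * (matrix_power A n $ k $ j / fact n))
        sums (\<Sum>k\<in>UNIV. A $ i $ k * matrix_exp A $ k $ j)"
      by (intro sums_sum sums_mult matrix_exp_entry_sums)
    then show "(\<lambda>n. (A ** matrix_power A n) $ i $ j / fact n) sums ((A ** matrix_exp A) $ i $ j)"
      by (simp add: matrix_matrix_mult_def sum_divide_distrib)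
    have "(\<lambda>n. \<Sum>k\<in>UNIV. matrix_power A n $ i $ k / fact n * A $ k $ j)
        sums (\<Sum>k\<in>UNIV. matrix_exp A $ i $ k * A $ k $ j)"
      by (intro sums_sum sums_mult2 matrix_exp_entry_sums)
    then show "(\<lambda>n. (A ** matrix_power A n) $ i $ j / fact n) sums ((matrix_exp A ** A) $ i $ j)"
      unfolding matrix_power_commute by (simp add: matrix_matrix_mult_def sum_divide_distrib)
  qed
  then show ?thesis by (simp add: vec_eq_iff)
qed

lemma matrix_exp_0 [simp]: "matrix_exp 0 = mat 1"
proof -
  have "matrix_exp 0 $ i $ j = mat 1 $ i $ j" for i j
    using matrix_exp_scaleR_entry[of 0 0 i j] powser_zero[of "\<lambda>n. matrix_power 0 n $ i $ j / fact n"] by simp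
  then show ?thesis by (simp add: vec_eq_iff)
qed

lemma matrix_exp_scaleR_commute: "A ** matrix_exp (t *\<^sub>R A) = matrix_exp (t *\<^sub>R A) ** A"
proof (cases "t = 0")
  case True
  then show ?thesis by simp
next
  case False
  then show ?thesis
    using matrix_exp_commute[of "t *\<^sub>R A"] by (simp add: matrix_mult.scaleR_left matrix_mult.scaleR_right)
qed

text \<open>The product has derivative zero, since \<open>A\<close> commutes with its exponential.
  The choice of the exponential itself for \<open>F\<close> gives its inverse; a general
  \<open>F\<close> gives uniqueness for the linear equation, through which later identities are
  verified.\<close>

lemma matrix_exp_inverse_flow:
  assumes F: "\<And>t. (F has_vector_derivative A ** F t) (at t)" "F 0 = mat 1"
  shows "matrix_exp ((- t) *\<^sub>R A) ** F t = mat 1"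
proof -
  have e: "((\<lambda>t. matrix_exp ((- t) *\<^sub>R A)) has_vector_derivative
      - (A ** matrix_exp ((- t) *\<^sub>R A))) (at t)" for t
  proof -
    have "(uminus has_vector_derivative - 1) (at t)"
      by (auto intro!: derivative_eq_intros)
    from vector_diff_chain_at[OF this has_vector_derivative_matrix_exp] show ?thesis
      by (simp add: o_def)
  qed
  have "((\<lambda>t. matrix_exp ((- t) *\<^sub>R A) ** F t) has_vector_derivative 0) (at t)" for t
    using matrix_mult.has_vector_derivative[OF e F(1), of t] matrix_exp_scaleR_commute[of A "- t"]
    by (simp add: matrix_mult.minus_left matrix_mul_assoc)
  then obtain c where "\<And>t. matrix_exp ((- t) *\<^sub>R A) ** F t = c"
    using has_vector_derivative_zero_constant[of UNIV "\<lambda>t. matrix_exp ((- t) *\<^sub>R A) ** F t"] by auto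
  from this[of 0] this[of t] show ?thesis using F(2) by simp
qed

lemma matrix_exp_minus: "matrix_exp (t *\<^sub>R A) ** matrix_exp ((- t) *\<^sub>R A) = mat 1"
  using matrix_exp_inverse_flow[of "\<lambda>t. matrix_exp (t *\<^sub>R A)" A "- t"]
    has_vector_derivative_matrix_exp by simp

lemma matrix_exp_unique:
  assumes "\<And>t. (F has_vector_derivative A ** F t) (at t)" "F 0 = mat 1"
  shows "F t = matrix_exp (t *\<^sub>R A)"
  using matrix_exp_inverse_flow[OF assms, of t] matrix_exp_minus[of t A]
  by (metis matrix_mul_assoc matrix_mul_lid matrix_mul_rid)

lemma matrix_exp_add:
  "matrix_exp ((s + t) *\<^sub>R A) = matrix_exp (t *\<^sub>R A) ** matrix_exp (s *\<^sub>R A)"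
proof -
  let ?F = "\<lambda>t. matrix_exp ((s + t) *\<^sub>R A) ** matrix_exp ((- s) *\<^sub>R A)"
  have "(?F has_vector_derivative A ** ?F t) (at t)" for t
  proof -
    have "((\<lambda>t. matrix_exp ((s + t) *\<^sub>R A)) has_vector_derivative
        A ** matrix_exp ((s + t) *\<^sub>R A)) (at t)"
    proof -
      have "((\<lambda>t. s + t) has_vector_derivative 1) (at t)"
        by (auto intro!: derivative_eq_intros)
      from vector_diff_chain_at[OF this has_vector_derivative_matrix_exp] show ?thesis
        by (simp add: o_def)
    qed
    from bounded_linear.has_vector_derivative[OF matrix_mult.bounded_linear_left this]
    show ?thesis by (simp add: matrix_mul_assoc)
  qed
  then have "?F t = matrix_exp (t *\<^sub>R A)"
    using matrix_exp_minus[of s A] by (intro matrix_exp_unique) simp_all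
  then show ?thesis
    using matrix_exp_minus[of "- s" A] by (metis matrix_mul_assoc matrix_mul_rid minus_minus)
qed

section \<open>Injectivity of the exponential for real spectra\<close>

lemma matrix_exp_nat_cong:
  assumes "matrix_exp X = matrix_exp Y"
  shows "matrix_exp (real n *\<^sub>R X) = matrix_exp (real n *\<^sub>R Y)"
proof (induction n)
  case (Suc n)
  then show ?case
    using matrix_exp_add[of "real n" 1 X] matrix_exp_add[of "real n" 1 Y] assms
    by (simp add: add.commute)
qed simp

text \<open>The hypotheses say that the product of the operators \<open>d/dt - z k\<close> kills
  \<open>f 0\<close>. By Rolle, zeros of \<open>f 0\<close> beyond every bound force such zeros of
  \<open>f 1\<close>, and the induction applies to the shorter chain.\<close>

lemma iterated_first_order_zero:
  fixes f :: "nat \<Rightarrow> real \<Rightarrow> real"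
  assumes "\<And>k t. k < n \<Longrightarrow> (f k has_real_derivative z k * f k t + f (Suc k) t) (at t)"
    and "\<And>t. f n t = 0" and "\<And>T. \<exists>t>T. f 0 t = 0"
  shows "f 0 t = 0"
  using assms
proof (induction n arbitrary: f z t)
  case (Suc n)
  \<comment> \<open>The integrating factor turns the first equation into
    \<open>g' = exp (- z 0 * t) * f 1 t\<close>, so zeros of \<open>g'\<close> are zeros of
    \<open>f 1\<close>.\<close>
  define g where "g t = exp (- z 0 * t) * f 0 t" for t
  have g: "(g has_real_derivative exp (- z 0 * t) * f 1 t) (at t)" for t
    unfolding g_def using Suc.prems(1)[of 0 t]
    by (auto intro!: derivative_eq_intros simp: algebra_simps)
  have zeros: "\<exists>t>T. f 1 t = 0" for T
  proof -
    obtain a where a: "a > T" "f 0 a = 0" using Suc.prems(3) by blast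
    obtain b where b: "b > a" "f 0 b = 0" using Suc.prems(3) by blast
    obtain c where "a < c" "c < b" "g b - g a = (b - a) * (exp (- z 0 * c) * f 1 c)"
      using MVT2[OF b(1) g] by blast
    moreover have "g a = 0" "g b = 0" using a b by (simp_all add: g_def)
    ultimately show ?thesis using a by (intro exI[of _ c]) auto
  qed
  have "f 1 t = 0" for t
    using Suc.IH[of "\<lambda>k. f (Suc k)" "\<lambda>k. z (Suc k)" t] Suc.prems(1,2) zeros by simp
  then have "(g has_vector_derivative 0) (at t)" for t
    using g[of t] by (simp add: has_real_derivative_iff_has_vector_derivative)
  then obtain c where "\<And>t. g t = c"
    using has_vector_derivative_zero_constant[of UNIV g] by auto
  moreover obtain a where "f 0 a = 0" using Suc.prems(3) by blast
  ultimately have "g t = 0" using \<open>\<And>t. g t = c\<close>[of a] by (simp add: g_def)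
  then show ?case by (simp add: g_def)
qed simp

text \<open>The product of the factors \<open>X - mat z\<close>. The equation
  \<open>shifts X zs = 0\<close> says that a polynomial with the real roots \<open>zs\<close>
  annihilates \<open>X\<close>; it replaces a normal form.\<close>

definition shifts :: "real^3^3 \<Rightarrow> real list \<Rightarrow> real^3^3" where
  "shifts X zs = foldl (\<lambda>K z. K ** (X - mat z)) (mat 1) zs"

lemma mat_eq_scaleR: "mat z = z *\<^sub>R (mat 1 :: real^'n^'n)"
  by (simp add: vec_eq_iff mat_def)

lemma foldl_matrix_mult: "foldl (\<lambda>K z. K ** g z) (C ** K) zs = C ** foldl (\<lambda>K z. K ** g z) K zs"
  by (induction zs arbitrary: K) (simp_all add: matrix_mul_assoc[symmetric])

lemma shifts_append: "shifts X (xs @ ys) = shifts X xs ** shifts X ys"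
  using foldl_matrix_mult[of "\<lambda>z. X - mat z" "shifts X xs" "mat 1" ys] by (simp add: shifts_def)

text \<open>Real roots are essential: a rotation generator of angle 2 pi has the same exponential as
  0. With real roots no entry of the difference of the two flows can oscillate, so agreement at the
  natural numbers spreads to all times, and the derivative at 0 recovers the matrices.\<close>

lemma matrix_exp_inject:
  assumes "matrix_exp X = matrix_exp Y" "shifts X xs = 0" "shifts Y ys = 0"
  shows "X = Y"
proof -
  \<comment> \<open>The concatenated list annihilates both matrices, so a single sequence of
    exponents serves for the difference \<open>F\<close>.\<close>
  let ?zs = "xs @ ys"
  have zero: "shifts X ?zs = 0" "shifts Y ?zs = 0"
    using assms(2,3) by (simp_all add: shifts_append matrix_mult.zero_left matrix_mult.zero_right)
  define F where "F k t = shifts X (take k ?zs) ** matrix_exp (t *\<^sub>R X)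
      - shifts Y (take k ?zs) ** matrix_exp (t *\<^sub>R Y)" for k t
  have entry0: "F 0 t $ i $ j = 0" for t i j
  proof (rule iterated_first_order_zero[of "length ?zs" "\<lambda>k t. F k t $ i $ j" "\<lambda>k. ?zs ! k"])
    fix k t assume k: "k < length ?zs"
    have eq: "K ** (Z ** E) = z *\<^sub>R (K ** E) + (K ** (Z - mat z)) ** E" for K Z E :: "real^3^3" and z
      by (simp add: matrix_mult.diff_right matrix_mult.diff_left mat_eq_scaleR[of z]
          matrix_mult.scaleR_left matrix_mult.scaleR_right matrix_mul_assoc)
    have K: "shifts Z (take (Suc k) ?zs) = shifts Z (take k ?zs) ** (Z - mat (?zs ! k))" for Z
      unfolding take_Suc_conv_app_nth[OF k] by (simp add: shifts_def)
    have "(F k has_vector_derivative shifts X (take k ?zs) ** (X ** matrix_exp (t *\<^sub>R X))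
        - shifts Y (take k ?zs) ** (Y ** matrix_exp (t *\<^sub>R Y))) (at t)"
      unfolding F_def
      by (intro has_vector_derivative_diff has_vector_derivative_matrix_exp
          bounded_linear.has_vector_derivative[OF matrix_mult.bounded_linear_right])
    moreover have "shifts X (take k ?zs) ** (X ** matrix_exp (t *\<^sub>R X))
        - shifts Y (take k ?zs) ** (Y ** matrix_exp (t *\<^sub>R Y)) = ?zs ! k *\<^sub>R F k t + F (Suc k) t"
      by (simp only: F_def K eq[of _ _ _ "?zs ! k"]) (simp add: algebra_simps)
    ultimately have "(F k has_vector_derivative ?zs ! k *\<^sub>R F k t + F (Suc k) t) (at t)" by simp
    from has_vector_derivative_entry[OF this, of i j]
    show "((\<lambda>t. F k t $ i $ j) has_real_derivative ?zs ! k * F k t $ i $ j + F (Suc k) t $ i $ j) (at t)"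
      by simp
  next
    show "F (length ?zs) t $ i $ j = 0" for t using zero by (simp add: F_def)
    show "\<exists>t>T. F 0 t $ i $ j = 0" for T
      using matrix_exp_nat_cong[OF assms(1)] reals_Archimedean2[of T]
      by (auto simp: F_def shifts_def)
  qed
  then have eq: "matrix_exp (t *\<^sub>R X) = matrix_exp (t *\<^sub>R Y)" for t
    by (simp add: F_def shifts_def vec_eq_iff)
  have "X ** matrix_exp (0 *\<^sub>R X) = Y ** matrix_exp (0 *\<^sub>R Y)"
    using has_vector_derivative_matrix_exp[of X 0] has_vector_derivative_matrix_exp[of Y 0]
    unfolding eq by (rule vector_derivative_unique_at)
  then show ?thesis by simp
qed

section \<open>Spectrum, Cayley-Hamilton and the principal logarithm\<close>

lemma complex_eigenvalueI:
  assumes "z ^ 3 - of_real (X $ 1 $ 1 + X $ 2 $ 2 + X $ 3 $ 3) * z ^ 2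
    + of_real (X $ 1 $ 1 * X $ 2 $ 2 - X $ 1 $ 2 * X $ 2 $ 1 + X $ 1 $ 1 * X $ 3 $ 3
      - X $ 1 $ 3 * X $ 3 $ 1 + X $ 2 $ 2 * X $ 3 $ 3 - X $ 2 $ 3 * X $ 3 $ 2) * z
    - of_real (det X) = 0"
  shows "complex_eigenvalue X z"
proof -
  let ?C = "(\<chi> i j. complex_of_real (X $ i $ j)) :: complex^3^3"
  have "det (?C - mat z) = 0"
    using assms by (simp add: det_3 mat_def) algebra
  then have "\<not> (\<exists>B. B ** (?C - mat z) = mat 1)"
    using invertible_det_nz[of "?C - mat z"] by (simp add: invertible_left_inverse)
  then obtain w where w: "(?C - mat z) *v w = 0" "w \<noteq> 0"
    unfolding matrix_left_invertible_ker by blast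
  have "mat z *v w = z *s w"
    by (simp add: vec_eq_iff matrix_vector_mult_def mat_def if_distrib[where f = "\<lambda>c. c * _"] cong: if_cong)
  then have "?C *v w = z *s w"
    using w(1) by (simp add: matrix_vector_mult_diff_rdistrib)
  then show ?thesis using w(2) unfolding complex_eigenvalue_def by blast
qed

lemma complex_cubic_roots:
  fixes a b c :: complex
  obtains x y z where "x + y + z = a" "x * y + y * z + z * x = b" "x * y * z = c"
    "\<And>t. t ^ 3 - a * t ^ 2 + b * t - c = (t - x) * (t - y) * (t - z)"
proof -
  have "\<not> constant (poly [:- c, b, - a, 1:])" by (simp add: constant_degree)
  then obtain x where "poly [:- c, b, - a, 1:] x = 0" using fundamental_theorem_of_algebra by blast
  then have x: "c = x * (b - x * (a - x))" by (simp add: algebra_simps)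
  \<comment> \<open>After the root \<open>x\<close> is split off, the quadratic with root sum
    \<open>a - x\<close> and root product \<open>b - x * (a - x)\<close> remains; \<open>s\<close>
    is a square root of its discriminant.\<close>
  define s where "s = csqrt ((a - x) ^ 2 - 4 * (b - x * (a - x)))"
  have s: "s * s = (a - x) ^ 2 - 4 * (b - x * (a - x))"
    by (simp add: s_def power2_eq_square[symmetric])
  define y z where "y = (a - x + s) / 2" and "z = (a - x - s) / 2"
  have sum: "y + z = a - x" by (simp add: y_def z_def field_simps)
  have "4 * (y * z) = (a - x) ^ 2 - s * s" by (simp add: y_def z_def field_simps power2_eq_square)
  then have "4 * (y * z) = 4 * (b - x * (a - x))" by (simp add: s)
  then have prod: "y * z = b - x * (a - x)" by (simp only: mult_cancel_left) simp
  have a: "a = x + y + z" using sum by (simp add: eq_diff_eq add_ac)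
  have b: "b = x * y + y * z + z * x" using prod by (simp add: a algebra_simps)
  have c: "c = x * y * z" using x prod by simp
  show thesis
    by (rule that[of x y z]) (simp_all add: a b c algebra_simps power2_eq_square power3_eq_cube)
qed

text \<open>This is Cayley-Hamilton: the assumptions match \<open>a\<close>, \<open>b\<close>,
  \<open>c\<close> by Vieta with the trace, the sum of the principal 2 by 2 minors and the
  determinant.\<close>

lemma shifts_char_roots:
  assumes "a + b + c = X $ 1 $ 1 + X $ 2 $ 2 + X $ 3 $ 3"
    and "a * b + b * c + c * a = X $ 1 $ 1 * X $ 2 $ 2 - X $ 1 $ 2 * X $ 2 $ 1 + X $ 1 $ 1 * X $ 3 $ 3
      - X $ 1 $ 3 * X $ 3 $ 1 + X $ 2 $ 2 * X $ 3 $ 3 - X $ 2 $ 3 * X $ 3 $ 2"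
    and "a * b * c = det X"
  shows "shifts X [a, b, c] = 0"
proof -
  have "shifts X [a, b, c] = X ** X ** X - (a + b + c) *\<^sub>R (X ** X)
      + (a * b + b * c + c * a) *\<^sub>R X - (a * b * c) *\<^sub>R mat 1"
    by (simp add: shifts_def mat_eq_scaleR[of a] mat_eq_scaleR[of b] mat_eq_scaleR[of c]
        matrix_mult.diff_left matrix_mult.diff_right matrix_mult.scaleR_left matrix_mult.scaleR_right)
      (simp add: algebra_simps scaleR_add_left)
  also have "\<dots> = 0"
    unfolding assms
    by (simp add: vec_eq_iff forall_3 matrix_matrix_mult_def sum_3 det_3 mat_def algebra_simps)
  finally show ?thesis .
qed

text \<open>The same eigenvector works: each power acts on it as \<open>z ^ n\<close>, and the
  exponential series is summed coordinatewise.\<close>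

lemma complex_eigenvalue_matrix_exp:
  assumes "complex_eigenvalue X z"
  shows "complex_eigenvalue (matrix_exp X) (exp z)"
proof -
  obtain w :: "complex^3" where w: "w \<noteq> 0" "(\<chi> i j. complex_of_real (X $ i $ j)) *v w = z *s w"
    using assms by (auto simp: complex_eigenvalue_def)
  have eig: "(\<Sum>j\<in>UNIV. of_real (X $ i $ j) * w $ j) = z * w $ i" for i
    using w(2) by (simp add: vec_eq_iff matrix_vector_mult_def)
  have pow: "(\<Sum>j\<in>UNIV. of_real (matrix_power X n $ i $ j) * w $ j) = z ^ n * w $ i" for n i
  proof (induction n arbitrary: i)
    case 0
    show ?case
      by (simp add: mat_def if_distrib[where f = of_real] if_distrib[where f = "\<lambda>c. c * _"] cong: if_cong)
  next
    case (Suc n)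
    have "(\<Sum>j\<in>UNIV. of_real (matrix_power X (Suc n) $ i $ j) * w $ j)
        = (\<Sum>j\<in>UNIV. \<Sum>k\<in>UNIV. of_real (X $ i $ k) * (of_real (matrix_power X n $ k $ j) * w $ j))"
      by (simp add: matrix_matrix_mult_def sum_distrib_right mult.assoc)
    also have "\<dots> = (\<Sum>k\<in>UNIV. of_real (X $ i $ k) * (\<Sum>j\<in>UNIV. of_real (matrix_power X n $ k $ j) * w $ j))"
      by (subst sum.swap) (simp add: sum_distrib_left)
    also have "\<dots> = (\<Sum>k\<in>UNIV. of_real (X $ i $ k) * (z ^ n * w $ k))"
      by (simp only: Suc.IH)
    also have "\<dots> = z ^ n * (\<Sum>k\<in>UNIV. of_real (X $ i $ k) * w $ k)"
      by (simp add: sum_distrib_left mult_ac)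
    finally show ?case unfolding eig by (simp add: mult_ac)
  qed
  have "(\<Sum>j\<in>UNIV. of_real (matrix_exp X $ i $ j) * w $ j) = exp z * w $ i" for i
  proof (rule sums_unique2)
    have "(\<lambda>n. \<Sum>j\<in>UNIV. of_real (matrix_power X n $ i $ j / fact n) * w $ j)
        sums (\<Sum>j\<in>UNIV. of_real (matrix_exp X $ i $ j) * w $ j)"
      by (intro sums_sum sums_mult2 sums_of_real matrix_exp_entry_sums)
    moreover have "(\<Sum>j\<in>UNIV. of_real (matrix_power X n $ i $ j / fact n) * w $ j)
        = z ^ n /\<^sub>R fact n * w $ i" for n
    proof -
      have "(\<Sum>j\<in>UNIV. of_real (matrix_power X n $ i $ j / fact n) * w $ j)
          = (\<Sum>j\<in>UNIV. of_real (matrix_power X n $ i $ j) * w $ j) / fact n"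
        by (simp add: sum_divide_distrib)
      then show ?thesis unfolding pow by (simp add: scaleR_conv_of_real divide_inverse mult_ac)
    qed
    ultimately show "(\<lambda>n. z ^ n /\<^sub>R fact n * w $ i)
        sums (\<Sum>j\<in>UNIV. of_real (matrix_exp X $ i $ j) * w $ j)" by simp
    show "(\<lambda>n. z ^ n /\<^sub>R fact n * w $ i) sums (exp z * w $ i)"
      by (intro sums_mult2 exp_converges)
  qed
  then have "(\<chi> i j. complex_of_real (matrix_exp X $ i $ j)) *v w = exp z *s w"
    by (simp add: vec_eq_iff matrix_vector_mult_def)
  then show ?thesis using w(1) unfolding complex_eigenvalue_def by blast
qed

text \<open>The row of the first nonzero coordinate of an eigenvector reduces to its diagonal
  term.\<close>

lemma complex_eigenvalue_lower_triangular:
  assumes "lower_triangular X" "complex_eigenvalue X z"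
  shows "\<exists>i. z = of_real (X $ i $ i)"
proof -
  obtain w :: "complex^3" where w: "w \<noteq> 0" "(\<chi> i j. complex_of_real (X $ i $ j)) *v w = z *s w"
    using assms(2) by (auto simp: complex_eigenvalue_def)
  have "of_real (X $ 1 $ 1) * w $ 1 = z * w $ 1"
    "of_real (X $ 2 $ 1) * w $ 1 + of_real (X $ 2 $ 2) * w $ 2 = z * w $ 2"
    "of_real (X $ 3 $ 1) * w $ 1 + of_real (X $ 3 $ 2) * w $ 2 + of_real (X $ 3 $ 3) * w $ 3 = z * w $ 3"
    using w(2) assms(1)
    by (simp_all add: vec_eq_iff forall_3 matrix_vector_mult_def sum_3 lower_triangular_def)
  moreover have "w $ 1 \<noteq> 0 \<or> w $ 2 \<noteq> 0 \<or> w $ 3 \<noteq> 0"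
    using w(1) by (auto simp: vec_eq_iff forall_3)
  ultimately show ?thesis
    by (metis add_0 mult_zero_right mult_cancel_right)
qed

lemma principal_log_matrix_exp:
  assumes M: "lower_triangular M" and T: "lower_triangular (matrix_exp M)"
    and pos: "\<And>i. 0 < matrix_exp M $ i $ i"
  shows "principal_log (matrix_exp M) = M"
proof -
  have strip: "\<bar>Im z\<bar> < pi" if "complex_eigenvalue M z" for z
    using complex_eigenvalue_lower_triangular[OF M that] pi_gt_zero by auto
  have shifts: "\<exists>zs. shifts X zs = 0"
    if X: "matrix_exp X = matrix_exp M" "\<And>z. complex_eigenvalue X z \<Longrightarrow> \<bar>Im z\<bar> < pi" for X
  proof -
    have real: "z = of_real (Re z)" if eig: "complex_eigenvalue X z" for z
    proof -
      obtain i where i: "exp z = of_real (matrix_exp M $ i $ i)"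
        using complex_eigenvalue_matrix_exp[OF eig] complex_eigenvalue_lower_triangular[OF T]
        unfolding X(1) by blast
      \<comment> \<open>The imaginary part of \<open>exp z\<close> is
        \<open>exp (Re z) * sin (Im z)\<close>, and \<open>exp z\<close> is real. The open strip
        leaves 0 as the only zero of the sine.\<close>
      then have "sin (Im z) = 0" using Im_exp[of z] by simp
      then have "Im z = 0" using X(2)[OF eig] sin_eq_0_pi by fastforce
      then show ?thesis by (simp add: complex_eq_iff)
    qed
    let ?t = "X $ 1 $ 1 + X $ 2 $ 2 + X $ 3 $ 3"
    let ?m = "X $ 1 $ 1 * X $ 2 $ 2 - X $ 1 $ 2 * X $ 2 $ 1 + X $ 1 $ 1 * X $ 3 $ 3
      - X $ 1 $ 3 * X $ 3 $ 1 + X $ 2 $ 2 * X $ 3 $ 3 - X $ 2 $ 3 * X $ 3 $ 2"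
    obtain x y z :: complex where xyz: "x + y + z = of_real ?t" "x * y + y * z + z * x = of_real ?m"
      "x * y * z = of_real (det X)"
      "\<And>t. t ^ 3 - of_real ?t * t ^ 2 + of_real ?m * t - of_real (det X) = (t - x) * (t - y) * (t - z)"
      by (rule complex_cubic_roots[of "of_real ?t" "of_real ?m" "of_real (det X)"]) (rule that)
    have eig: "complex_eigenvalue X x" "complex_eigenvalue X y" "complex_eigenvalue X z"
      using xyz(4) by (intro complex_eigenvalueI; simp only: mult_eq_0_iff; simp)+
    then obtain a b c where abc: "x = of_real a" "y = of_real b" "z = of_real c" using real[OF eig(1)] real[OF eig(2)] real[OF eig(3)] by blast
    have "shifts X [a, b, c] = 0"
      using xyz(1-3) unfolding abc of_real_add[symmetric] of_real_mult[symmetric] of_real_eq_iff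
      by (intro shifts_char_roots)
    then show ?thesis by blast
  qed
  show ?thesis
    unfolding principal_log_def
    using strip shifts[of M] shifts matrix_exp_inject
    by (intro the_equality) blast+
qed

section \<open>The exponential of lower triangular matrices in closed form\<close>

definition expm1_quot :: "real \<Rightarrow> real" where
  "expm1_quot t = (if t = 0 then 1 else (exp t - 1) / t)"

lemma expm1_quot_pos: "0 < expm1_quot t"
  by (auto simp: expm1_quot_def zero_less_divide_iff)

lemma expm1_quot_sums: "(\<lambda>n. inverse (fact (Suc n)) * t ^ n) sums expm1_quot t"
proof (cases "t = 0")
  case True
  then show ?thesis using powser_sums_zero[of "\<lambda>n. inverse (fact (Suc n)) :: real"]
    by (simp add: expm1_quot_def)
next
  case False
  have "(\<lambda>n. inverse (fact (Suc n)) * t ^ Suc n) sums (exp t - 1)"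
    using exp_converges[of t] by (subst sums_Suc_iff) simp
  from sums_divide[OF this, of t] show ?thesis
    using False by (simp add: expm1_quot_def mult.assoc)
qed

lemma smooth_on_expm1_quot: "smooth_on UNIV expm1_quot"
proof -
  have "expm1_quot = (\<lambda>t. \<Sum>n. inverse (fact (Suc n)) * t ^ n)"
    using sums_unique[OF expm1_quot_sums] by auto
  then show ?thesis
    using smooth_on_powser[of "\<lambda>n. inverse (fact (Suc n))"] sums_summable[OF expm1_quot_sums] by simp
qed

text \<open>The lower triangular matrices with vanishing (2,1) entry, where lower parts and Cholesky
  factors of elements of the cone live. They are closed under multiplication, which is why the
  exponential keeps this shape.\<close>

definition clan_lower :: "real \<Rightarrow> real \<Rightarrow> real \<Rightarrow> real \<Rightarrow> real \<Rightarrow> real^3^3" where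
  "clan_lower a b c p q = vector [vector [a, 0, 0], vector [0, b, 0], vector [p, q, c]]"

text \<open>The function is the divided difference
  \<open>(exp (t * a) - exp (t * c)) / (a - c)\<close>, extended to \<open>a = c\<close>. It solves
  \<open>y' = c * y + exp (t * a)\<close>, the equation for an off-diagonal entry of the flow up to
  the factor \<open>p\<close>.\<close>

lemma has_real_derivative_divided_exp:
  "((\<lambda>t. t * (exp (t * c) * expm1_quot (t * a - t * c))) has_real_derivative
    exp (t * a) + c * (t * (exp (t * c) * expm1_quot (t * a - t * c)))) (at t)"
proof (cases "a = c")
  case True
  then show ?thesis
    by (auto simp: expm1_quot_def algebra_simps intro!: derivative_eq_intros)
next
  case False
  have *: "t * (exp (t * c) * expm1_quot (t * a - t * c)) = (exp (t * a) - exp (t * c)) / (a - c)" for t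
  proof (cases "t = 0")
    case t: False
    have "expm1_quot (t * a - t * c) = (exp (t * a - t * c) - 1) / (t * (a - c))"
      using False t by (simp add: expm1_quot_def right_diff_distrib)
    moreover have "exp (t * c) * (exp (t * a - t * c) - 1) = exp (t * a) - exp (t * c)"
      by (simp add: right_diff_distrib exp_add[symmetric])
    ultimately show ?thesis using t by simp
  qed simp
  have "((\<lambda>t. (exp (t * a) - exp (t * c)) / (a - c)) has_real_derivative
      (exp (t * a) * a - exp (t * c) * c) / (a - c)) (at t)"
    by (intro DERIV_cdivide DERIV_diff) (auto intro!: derivative_eq_intros)
  moreover have "(exp (t * a) * a - exp (t * c) * c) / (a - c)
      = exp (t * a) + c * ((exp (t * a) - exp (t * c)) / (a - c))"
    using False by (simp add: divide_simps) (simp add: algebra_simps)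
  ultimately show ?thesis unfolding * by simp
qed

lemma matrix_exp_clan_lower:
  "matrix_exp (clan_lower a b c p q) = clan_lower (exp a) (exp b) (exp c)
    (p * (exp c * expm1_quot (a - c))) (q * (exp c * expm1_quot (b - c)))"
proof -
  let ?F = "\<lambda>t. clan_lower (exp (t * a)) (exp (t * b)) (exp (t * c))
    (p * (t * (exp (t * c) * expm1_quot (t * a - t * c))))
    (q * (t * (exp (t * c) * expm1_quot (t * b - t * c))))"
  have "(?F has_vector_derivative clan_lower a b c p q ** ?F t) (at t)" for t
  proof (rule has_vector_derivative_entries)
    fix i j :: 3
    have "((\<lambda>t. p * (t * (exp (t * c) * expm1_quot (t * a - t * c)))) has_real_derivative
        p * exp (t * a) + c * (p * (t * (exp (t * c) * expm1_quot (t * a - t * c))))) (at t)" for p a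
      using DERIV_cmult[OF has_real_derivative_divided_exp[of c a t], of p] by (simp add: algebra_simps)
    moreover have "((\<lambda>t. exp (t * a)) has_real_derivative a * exp (t * a)) (at t)" for a
      by (auto intro!: derivative_eq_intros)
    ultimately show "((\<lambda>t. ?F t $ i $ j) has_real_derivative (clan_lower a b c p q ** ?F t) $ i $ j) (at t)"
      using exhaust_3[of i] exhaust_3[of j]
      by (elim disjE) (simp_all add: clan_lower_def matrix_matrix_mult_def sum_3)
  qed
  moreover have "?F 0 = mat 1" by (simp add: clan_lower_def mat_def vec_eq_iff forall_3)
  ultimately have "?F 1 = matrix_exp (1 *\<^sub>R clan_lower a b c p q)" by (rule matrix_exp_unique)
  then show ?thesis by simp
qed

section \<open>The clan exponential and logarithm in coordinates\<close>

lemma matrix_of_sym: "matrix_of x $ i $ j = matrix_of x $ j $ i"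
  using matrix_of[of x] by (simp add: transpose_def vec_eq_iff)

lemma matrix_of_zero: "matrix_of x $ 1 $ 2 = 0" "matrix_of x $ 2 $ 1 = 0"
  using matrix_of[of x] by simp_all

lemmas matrix_of_V_coords = inner_V_coords(2)

lemma V_coords_matrix_of:
  "V_coords (matrix_of x $ 1 $ 1) (matrix_of x $ 2 $ 2) (matrix_of x $ 3 $ 3)
    (matrix_of x $ 1 $ 3) (matrix_of x $ 2 $ 3) = x"
  using matrix_of_sym[of x 3 1] matrix_of_sym[of x 3 2] matrix_of_zero[of x]
  by (simp add: matrix_of_inject[symmetric] matrix_of_V_coords vec_eq_iff forall_3)

lemma V_coords_exhaust: obtains a b c p q where "x = V_coords a b c p q"
  using V_coords_matrix_of[of x] by metis

lemma V_coords_eq_iff: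
  "V_coords a b c p q = V_coords a' b' c' p' q' \<longleftrightarrow> a = a' \<and> b = b' \<and> c = c' \<and> p = p' \<and> q = q'"
  by (auto simp: matrix_of_inject[symmetric] matrix_of_V_coords vec_eq_iff forall_3)

lemma V_coords_eq_combination:
  "V_coords a b c p q = a *\<^sub>R V_coords 1 0 0 0 0 + b *\<^sub>R V_coords 0 1 0 0 0
    + c *\<^sub>R V_coords 0 0 1 0 0 + p *\<^sub>R V_coords 0 0 0 1 0 + q *\<^sub>R V_coords 0 0 0 0 1"
  by (simp add: matrix_of_inject[symmetric] matrix_of_V_coords plus_V.rep_eq scaleR_V.rep_eq
      vec_eq_iff forall_3)

lemma bounded_linear_matrix_entry: "bounded_linear (\<lambda>x. matrix_of x $ i $ j)"
  by (rule linear_conv_bounded_linear[THEN iffD1])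
    (simp add: linear_iff plus_V.rep_eq scaleR_V.rep_eq)

lemmas smooth_on_matrix_entry [smooth_intros] = smooth_on_bounded_linear[OF bounded_linear_matrix_entry]

lemma smooth_on_V_coords [smooth_intros]:
  assumes "open S" "smooth_on S a" "smooth_on S b" "smooth_on S c" "smooth_on S p" "smooth_on S q"
  shows "smooth_on S (\<lambda>x. V_coords (a x) (b x) (c x) (p x) (q x))"
  by (subst V_coords_eq_combination) (intro smooth_intros assms)

section \<open>Lower parts, Cholesky factors and the exponential map\<close>

lemma lower_triangular_clan_lower: "lower_triangular (clan_lower a b c p q)"
  by (simp add: lower_triangular_def clan_lower_def)

lemma lower_triangular_eq_clan_lower:
  assumes "lower_triangular L" "L $ 2 $ 1 = 0"
  shows "L = clan_lower (L $ 1 $ 1) (L $ 2 $ 2) (L $ 3 $ 3) (L $ 3 $ 1) (L $ 3 $ 2)"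
  using assms by (simp add: lower_triangular_def clan_lower_def vec_eq_iff forall_3)

lemma clan_lower_add_transpose:
  "clan_lower a b c p q + transpose (clan_lower a b c p q) = matrix_of (V_coords (2 * a) (2 * b) (2 * c) p q)"
  by (simp add: clan_lower_def matrix_of_V_coords vec_eq_iff forall_3 transpose_def)

lemma clan_lower_mult_transpose:
  "clan_lower a b c p q ** transpose (clan_lower a b c p q)
    = matrix_of (V_coords (a\<^sup>2) (b\<^sup>2) (p\<^sup>2 + q\<^sup>2 + c\<^sup>2) (a * p) (b * q))"
  by (simp add: clan_lower_def matrix_of_V_coords vec_eq_iff forall_3 transpose_def
      matrix_matrix_mult_def sum_3 power2_eq_square)

lemma lower_part_V_coords: "lower_part (V_coords a b c p q) = clan_lower (a / 2) (b / 2) (c / 2) p q"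
  unfolding lower_part_def
proof (rule the_equality)
  show "lower_triangular (clan_lower (a / 2) (b / 2) (c / 2) p q) \<and>
      matrix_of (V_coords a b c p q)
        = clan_lower (a / 2) (b / 2) (c / 2) p q + transpose (clan_lower (a / 2) (b / 2) (c / 2) p q)"
    by (simp add: lower_triangular_clan_lower clan_lower_add_transpose)
next
  fix L assume L: "lower_triangular L \<and> matrix_of (V_coords a b c p q) = L + transpose L"
  then have "2 * L $ 1 $ 1 = a" "2 * L $ 2 $ 2 = b" "2 * L $ 3 $ 3 = c" "L $ 3 $ 1 = p"
    "L $ 3 $ 2 = q" "L $ 2 $ 1 = 0"
    by (simp_all add: lower_triangular_def matrix_of_V_coords vec_eq_iff forall_3 transpose_def)
  then show "L = clan_lower (a / 2) (b / 2) (c / 2) p q"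
    using lower_triangular_eq_clan_lower[of L] L by auto
qed

text \<open>A competing factor is only known to be lower triangular. Its (2,1) entry vanishes by the
  (1,2) equation; after that the equations determine one entry at a time, with positivity deciding
  the square roots.\<close>

lemma cholesky_clan_lower:
  assumes "0 < a" "0 < b" "0 < c"
  shows "cholesky (V_of (clan_lower a b c p q ** transpose (clan_lower a b c p q))) = clan_lower a b c p q"
  unfolding cholesky_def
proof (rule the_equality)
  let ?L = "clan_lower a b c p q"
  have L: "matrix_of (V_of (?L ** transpose ?L)) = ?L ** transpose ?L"
    by (simp add: clan_lower_mult_transpose matrix_of_inverse)
  show "lower_triangular ?L \<and> (\<forall>i. 0 < ?L $ i $ i) \<and> matrix_of (V_of (?L ** transpose ?L)) = ?L ** transpose ?L"
    using assms by (simp add: L lower_triangular_clan_lower) (simp add: clan_lower_def forall_3)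
  fix M assume M: "lower_triangular M \<and> (\<forall>i. 0 < M $ i $ i) \<and> matrix_of (V_of (?L ** transpose ?L)) = M ** transpose M"
  then have pos: "0 < M $ 1 $ 1" "0 < M $ 2 $ 2" "0 < M $ 3 $ 3" by auto
  have "matrix_of (V_coords (a\<^sup>2) (b\<^sup>2) (p\<^sup>2 + q\<^sup>2 + c\<^sup>2) (a * p) (b * q)) = M ** transpose M"
    using M L by (simp add: clan_lower_mult_transpose)
  then have eq: "a\<^sup>2 = (M $ 1 $ 1)\<^sup>2" "0 = M $ 1 $ 1 * M $ 2 $ 1" "b\<^sup>2 = (M $ 2 $ 1)\<^sup>2 + (M $ 2 $ 2)\<^sup>2"
    "a * p = M $ 1 $ 1 * M $ 3 $ 1" "b * q = M $ 2 $ 1 * M $ 3 $ 1 + M $ 2 $ 2 * M $ 3 $ 2"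
    "p\<^sup>2 + q\<^sup>2 + c\<^sup>2 = (M $ 3 $ 1)\<^sup>2 + (M $ 3 $ 2)\<^sup>2 + (M $ 3 $ 3)\<^sup>2"
    using M by (simp_all add: matrix_of_V_coords vec_eq_iff forall_3
        lower_triangular_def transpose_def matrix_matrix_mult_def sum_3 power2_eq_square)
  have 1: "M $ 1 $ 1 = a" using eq(1) pos assms by (simp add: power2_eq_iff_nonneg)
  have 2: "M $ 2 $ 1 = 0" using eq(2) pos by simp
  have 3: "M $ 2 $ 2 = b" using eq(3) 2 pos assms by (simp add: power2_eq_iff_nonneg)
  have 4: "M $ 3 $ 1 = p" using eq(4) 1 assms by simp
  have 5: "M $ 3 $ 2 = q" using eq(5) 2 3 assms by simp
  have 6: "M $ 3 $ 3 = c" using eq(6) 4 5 pos assms by (simp add: power2_eq_iff_nonneg)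
  show "M = ?L" using lower_triangular_eq_clan_lower[of M] M 1 2 3 4 5 6 by simp
qed

lemma matrix_exp_clan_lower_triangular:
  "lower_triangular (matrix_exp (clan_lower a b c p q))" "0 < matrix_exp (clan_lower a b c p q) $ i $ i"
  unfolding matrix_exp_clan_lower
  using exhaust_3[of i] by (auto simp: lower_triangular_clan_lower) (auto simp: clan_lower_def)

text \<open>The exponential of the lower part is triangular with positive diagonal, hence it is
  itself the Cholesky factor of \<open>Exp_clan v\<close>, and its principal logarithm is the lower
  part again.\<close>

lemma Log_Exp: "Log_clan (Exp_clan v) = v"
proof -
  obtain a b c p q where v: "v = V_coords a b c p q" by (rule V_coords_exhaust)
  let ?L = "clan_lower (a / 2) (b / 2) (c / 2) p q"
  have "cholesky (Exp_clan v) = matrix_exp ?L"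
    unfolding v Exp_clan_def lower_part_V_coords matrix_exp_clan_lower
    by (rule cholesky_clan_lower) simp_all
  moreover have "principal_log (matrix_exp ?L) = ?L"
    by (intro principal_log_matrix_exp lower_triangular_clan_lower matrix_exp_clan_lower_triangular)
  ultimately show ?thesis
    by (simp add: Log_clan_def clan_lower_add_transpose matrix_of_inverse v)
qed

lemma Exp_clan_V_coords:
  fixes a b c p q
  defines "P \<equiv> p * (exp (c / 2) * expm1_quot (a / 2 - c / 2))"
    and "Q \<equiv> q * (exp (c / 2) * expm1_quot (b / 2 - c / 2))"
  shows "Exp_clan (V_coords a b c p q)
    = V_coords (exp a) (exp b) (P\<^sup>2 + Q\<^sup>2 + exp c) (exp (a / 2) * P) (exp (b / 2) * Q)"
  by (simp add: Exp_clan_def lower_part_V_coords matrix_exp_clan_lower clan_lower_mult_transpose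
      matrix_of_inverse P_def Q_def power2_eq_square exp_add[symmetric])

lemma V_coords_in_Omega_iff:
  "V_coords a b c p q \<in> \<Omega> \<longleftrightarrow> 0 < a \<and> 0 < b \<and> 0 < c - p\<^sup>2 / a - q\<^sup>2 / b"
proof -
  let ?M = "matrix_of (V_coords a b c p q)"
  let ?f = "\<lambda>x y z. a * x\<^sup>2 + b * y\<^sup>2 + c * z\<^sup>2 + 2 * p * x * z + 2 * q * y * z"
  have form: "w \<bullet> (?M *v w) = ?f (w $ 1) (w $ 2) (w $ 3)" for w
    by (simp add: inner_vec_def sum_3 matrix_vector_mult_def matrix_of_V_coords power2_eq_square algebra_simps)
  have "V_coords a b c p q \<in> \<Omega> \<longleftrightarrow> (\<forall>w::real^3. w \<noteq> 0 \<longrightarrow> 0 < ?f (w $ 1) (w $ 2) (w $ 3))"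
    using matrix_of[of "V_coords a b c p q"] by (simp add: \<Omega>_def positive_definite_def form)
  also have "\<dots> \<longleftrightarrow> 0 < a \<and> 0 < b \<and> 0 < c - p\<^sup>2 / a - q\<^sup>2 / b"
  proof
    assume f: "\<forall>w::real^3. w \<noteq> 0 \<longrightarrow> 0 < ?f (w $ 1) (w $ 2) (w $ 3)"
    have f: "0 < ?f x y z" if "x \<noteq> 0 \<or> y \<noteq> 0 \<or> z \<noteq> 0" for x y z
      using f[rule_format, of "vector [x, y, z]"] that by (auto simp: vec_eq_iff forall_3)
    have ab: "0 < a" "0 < b" using f[of 1 0 0] f[of 0 1 0] by simp_all
    \<comment> \<open>For \<open>z = 1\<close> this choice of \<open>x\<close> and \<open>y\<close>
      makes both completed squares vanish, so the form takes the Schur complement as its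
      value.\<close>
    moreover have "?f (- p / a) (- q / b) 1 = c - p\<^sup>2 / a - q\<^sup>2 / b"
      using ab by (simp add: field_simps power2_eq_square)
    ultimately show "0 < a \<and> 0 < b \<and> 0 < c - p\<^sup>2 / a - q\<^sup>2 / b"
      using f[of "- p / a" "- q / b" 1] by simp
  next
    assume *: "0 < a \<and> 0 < b \<and> 0 < c - p\<^sup>2 / a - q\<^sup>2 / b"
    show "\<forall>w::real^3. w \<noteq> 0 \<longrightarrow> 0 < ?f (w $ 1) (w $ 2) (w $ 3)"
    proof (intro allI impI)
      fix w :: "real^3" assume w: "w \<noteq> 0"
      let ?x = "w $ 1" and ?y = "w $ 2" and ?z = "w $ 3"
      have eq: "?f ?x ?y ?z = a * (?x + p * ?z / a)\<^sup>2 + b * (?y + q * ?z / b)\<^sup>2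
          + (c - p\<^sup>2 / a - q\<^sup>2 / b) * ?z\<^sup>2"
        using * by (simp add: field_simps power2_eq_square)
      show "0 < ?f ?x ?y ?z"
      proof (cases "?z = 0")
        case True
        then have "?x \<noteq> 0 \<or> ?y \<noteq> 0" using w by (auto simp: vec_eq_iff forall_3)
        then have "0 < a * ?x\<^sup>2 \<or> 0 < b * ?y\<^sup>2" "0 \<le> a * ?x\<^sup>2" "0 \<le> b * ?y\<^sup>2" using * by auto
        then show ?thesis using True by auto
      next
        case False
        then have "0 < (c - p\<^sup>2 / a - q\<^sup>2 / b) * ?z\<^sup>2" "0 \<le> a * (?x + p * ?z / a)\<^sup>2"
          "0 \<le> b * (?y + q * ?z / b)\<^sup>2" using * by simp_all
        then show ?thesis unfolding eq by linarith
      qed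
    qed
  qed
  finally show ?thesis .
qed

text \<open>The Schur complement of the diagonal upper left block. On the cone it is the square of
  the (3,3) Cholesky entry, so its logarithm is the (3,3) coordinate of
  \<open>Log_clan\<close>.\<close>

definition schur :: "V \<Rightarrow> real" where
  "schur x = matrix_of x $ 3 $ 3 - (matrix_of x $ 1 $ 3)\<^sup>2 / matrix_of x $ 1 $ 1
    - (matrix_of x $ 2 $ 3)\<^sup>2 / matrix_of x $ 2 $ 2"

lemma Omega_iff: "x \<in> \<Omega> \<longleftrightarrow> 0 < matrix_of x $ 1 $ 1 \<and> 0 < matrix_of x $ 2 $ 2 \<and> 0 < schur x"
  using V_coords_in_Omega_iff[of "matrix_of x $ 1 $ 1" "matrix_of x $ 2 $ 2" "matrix_of x $ 3 $ 3"
      "matrix_of x $ 1 $ 3" "matrix_of x $ 2 $ 3"]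
  unfolding V_coords_matrix_of schur_def .

lemma open_Omega: "open \<Omega>"
proof -
  have cont: "continuous_on S (\<lambda>x. matrix_of x $ i $ j)" for S i j
    by (rule linear_continuous_on[OF bounded_linear_matrix_entry])
  \<comment> \<open>The quotients in \<open>schur\<close> are continuous only where the first two
    diagonal entries do not vanish, so the open condition on these entries is imposed first.\<close>
  let ?U = "{x. 0 < matrix_of x $ 1 $ 1} \<inter> {x. 0 < matrix_of x $ 2 $ 2}"
  have U: "open ?U" by (intro open_Int open_Collect_less continuous_intros cont)
  moreover have "continuous_on ?U schur"
    unfolding schur_def by (intro continuous_intros cont) auto
  ultimately have "open (?U \<inter> schur -` {0<..})"
    by (intro continuous_open_preimage) auto
  moreover have "\<Omega> = ?U \<inter> schur -` {0<..}" by (auto simp: Omega_iff)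
  ultimately show ?thesis by simp
qed

lemma Exp_in_Omega: "Exp_clan v \<in> \<Omega>"
proof -
  obtain a b c p q where v: "v = V_coords a b c p q" by (rule V_coords_exhaust)
  have "(exp (t / 2))\<^sup>2 = exp t" for t :: real
    by (simp add: power2_eq_square exp_add[symmetric])
  then have "(exp (t / 2) * r)\<^sup>2 / exp t = r\<^sup>2" for t r :: real
    by (simp add: power_mult_distrib)
  then show ?thesis unfolding v Exp_clan_V_coords V_coords_in_Omega_iff by simp
qed

text \<open>The solution of the off-diagonal equation of \<open>Exp_clan_V_coords\<close>, where the
  diagonal coordinates are already known to be \<open>ln a\<close> and \<open>ln c\<close>, with
  \<open>c\<close> the Schur complement.\<close>

definition log_offdiag :: "real \<Rightarrow> real \<Rightarrow> real \<Rightarrow> real" where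
  "log_offdiag a c p = p / (exp (ln a / 2) * (exp (ln c / 2) * expm1_quot (ln a / 2 - ln c / 2)))"

definition log_coords :: "V \<Rightarrow> V" where
  "log_coords x = V_coords (ln (matrix_of x $ 1 $ 1)) (ln (matrix_of x $ 2 $ 2)) (ln (schur x))
    (log_offdiag (matrix_of x $ 1 $ 1) (schur x) (matrix_of x $ 1 $ 3))
    (log_offdiag (matrix_of x $ 2 $ 2) (schur x) (matrix_of x $ 2 $ 3))"

lemma Exp_log_coords:
  assumes "x \<in> \<Omega>"
  shows "Exp_clan (log_coords x) = x"
proof -
  have off: "log_offdiag a c p * (exp (ln c / 2) * expm1_quot (ln a / 2 - ln c / 2)) = p / exp (ln a / 2)"
    for a c p
    using expm1_quot_pos[of "ln a / 2 - ln c / 2"] by (simp add: log_offdiag_def)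
  have sq: "(p / exp (ln a / 2))\<^sup>2 = p\<^sup>2 / a" if "0 < a" for a p :: real
    using that by (simp add: power_divide power2_eq_square[of "exp _"] exp_add[symmetric])
  show ?thesis
    using assms unfolding log_coords_def Exp_clan_V_coords off
    by (subst V_coords_matrix_of[symmetric, of x])
      (simp add: V_coords_eq_iff Omega_iff sq, simp add: schur_def)
qed

text \<open>A left inverse and a right inverse of \<open>Exp_clan\<close> coincide; no principal
  logarithm of a general Cholesky factor has to be computed.\<close>

lemma Log_eq_log_coords: "x \<in> \<Omega> \<Longrightarrow> Log_clan x = log_coords x"
  using Log_Exp[of "log_coords x"] by (simp add: Exp_log_coords)

lemma smooth_on_exp_compose [smooth_intros]:
  "open S \<Longrightarrow> smooth_on S f \<Longrightarrow> smooth_on S (\<lambda>x. exp (f x :: real))"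
  by (rule smooth_on_compose[OF smooth_on_exp]) auto

lemma smooth_on_ln_compose [smooth_intros]:
  "open S \<Longrightarrow> smooth_on S f \<Longrightarrow> (\<And>x. x \<in> S \<Longrightarrow> 0 < f x) \<Longrightarrow> smooth_on S (\<lambda>x. ln (f x :: real))"
  by (rule smooth_on_compose[OF smooth_on_ln]) auto

lemma smooth_on_expm1_quot_compose [smooth_intros]:
  "open S \<Longrightarrow> smooth_on S f \<Longrightarrow> smooth_on S (\<lambda>x. expm1_quot (f x))"
  by (rule smooth_on_compose[OF smooth_on_expm1_quot]) auto

lemma smooth_on_Exp: "smooth_on UNIV Exp_clan"
proof -
  have "smooth_on UNIV (\<lambda>x. Exp_clan (V_coords (matrix_of x $ 1 $ 1) (matrix_of x $ 2 $ 2)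
      (matrix_of x $ 3 $ 3) (matrix_of x $ 1 $ 3) (matrix_of x $ 2 $ 3)))"
    unfolding Exp_clan_V_coords power2_eq_square by (intro smooth_intros open_UNIV) simp_all
  then show ?thesis unfolding V_coords_matrix_of .
qed

lemma smooth_on_Log: "smooth_on \<Omega> Log_clan"
proof (rule smooth_on_cong[OF open_Omega])
  have schur: "smooth_on \<Omega> schur"
    unfolding schur_def power2_eq_square
    by (intro smooth_intros open_Omega) (auto simp: Omega_iff)
  show "smooth_on \<Omega> log_coords"
    unfolding log_coords_def log_offdiag_def
    by (intro smooth_intros open_Omega schur) (auto simp: Omega_iff expm1_quot_pos less_imp_neq[symmetric])
qed (simp add: Log_eq_log_coords)

section \<open>The clan inner product\<close>

lemma clan_product_V_coords:
  "V_coords a b c p q \<Delta> V_coords a' b' c' p' q'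
    = V_coords (a * a') (b * b') (c * c' + 2 * (p * p' + q * q'))
        (p * a' + (a + c) / 2 * p') (q * b' + (b + c) / 2 * q')"
proof -
  let ?L = "clan_lower (a / 2) (b / 2) (c / 2) p q" and ?W = "matrix_of (V_coords a' b' c' p' q')"
  have "?L ** ?W + ?W ** transpose ?L = matrix_of (V_coords (a * a') (b * b')
      (c * c' + 2 * (p * p' + q * q')) (p * a' + (a + c) / 2 * p') (q * b' + (b + c) / 2 * q'))"
    by (simp add: clan_lower_def matrix_of_V_coords vec_eq_iff forall_3 transpose_def
        matrix_matrix_mult_def sum_3 algebra_simps)
  then show ?thesis by (simp add: clan_product_def lower_part_V_coords matrix_of_inverse)
qed

lemma trace_clan_product: "operator_trace (\<lambda>w. V_coords a b c p q \<Delta> w) = 3 / 2 * (a + b) + 2 * c"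
  unfolding operator_trace_def Basis_V_def
  by (simp add: V_coords_eq_iff clan_product_V_coords inner_V_coords field_simps)

text \<open>The positive square root of the Gram operator of \<open>Q_clan\<close> for the Frobenius
  product. The trace of a clan product gives weight \<open>3 / 2\<close> to the first two diagonal
  products and 2 to the third; the off-diagonal products get 4, of which the Frobenius product
  already supplies a factor 2.\<close>

definition Q_root :: "V \<Rightarrow> V" where
  "Q_root v = V_coords (sqrt (3 / 2) * matrix_of v $ 1 $ 1) (sqrt (3 / 2) * matrix_of v $ 2 $ 2)
    (sqrt 2 * matrix_of v $ 3 $ 3) (sqrt 2 * matrix_of v $ 1 $ 3) (sqrt 2 * matrix_of v $ 2 $ 3)"

lemma Q_clan_eq_inner: "Q_clan u v = Q_root u \<bullet> Q_root v"
proof -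
  obtain a b c p q where u: "u = V_coords a b c p q" by (rule V_coords_exhaust)
  obtain a' b' c' p' q' where v: "v = V_coords a' b' c' p' q'" by (rule V_coords_exhaust)
  have "sqrt (3 / 2) * x * (sqrt (3 / 2) * y) = 3 / 2 * (x * y)" "sqrt 2 * x * (sqrt 2 * y) = 2 * (x * y)"
    for x y :: real by (simp_all add: mult_ac)
  then show ?thesis
    unfolding u v Q_clan_def clan_product_V_coords trace_clan_product Q_root_def
    by (simp add: inner_V_coords) (simp add: algebra_simps)
qed

lemma bounded_linear_Q_root: "bounded_linear Q_root"
  by (rule linear_conv_bounded_linear[THEN iffD1])
    (simp add: linear_iff Q_root_def plus_V.rep_eq scaleR_V.rep_eq matrix_of_inject[symmetric]
      matrix_of_V_coords vec_eq_iff forall_3 algebra_simps)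

lemma inj_Q_root: "inj Q_root"
proof (rule injI)
  fix u v assume "Q_root u = Q_root v"
  then have "matrix_of u $ 1 $ 1 = matrix_of v $ 1 $ 1" "matrix_of u $ 2 $ 2 = matrix_of v $ 2 $ 2"
    "matrix_of u $ 3 $ 3 = matrix_of v $ 3 $ 3" "matrix_of u $ 1 $ 3 = matrix_of v $ 1 $ 3"
    "matrix_of u $ 2 $ 3 = matrix_of v $ 2 $ 3"
    by (simp_all add: Q_root_def V_coords_eq_iff)
  then show "u = v" by (metis V_coords_matrix_of)
qed

interpretation clan: flat_chart \<Omega> Log_clan Exp_clan Q_root
proof (rule flat_chart.intro)
  show "x \<in> \<Omega> \<Longrightarrow> Exp_clan (Log_clan x) = x" for x
    by (simp add: Log_eq_log_coords Exp_log_coords)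
qed (rule open_Omega smooth_on_Log smooth_on_Exp Exp_in_Omega Log_Exp bounded_linear_Q_root inj_Q_root)+

lemma g_clan_eq_metric: "g_clan = clan.pull_metric"
  by (intro ext) (simp add: g_clan_def clan.pull_metric_def Q_clan_eq_inner)

lemma nabla_clan_eq_nabla: "nabla_clan = clan.nabla"
  by (intro ext) (simp add: nabla_clan_def clan.nabla_def)

theorem proposition7p6:
  shows "(\<forall>x\<in>\<Omega>. \<forall>y\<in>\<Omega>.
            riemannian_distance \<Omega> g_clan x y = norm_clan (Log_clan x - Log_clan y))
       \<and> riemannian_complete \<Omega> g_clan
       \<and> is_levi_civita \<Omega> g_clan nabla_clan
       \<and> flat \<Omega> nabla_clan
       \<and> torsion_free \<Omega> nabla_clan"
proof -
  have "norm_clan (Log_clan x - Log_clan y) = norm (Q_root (Log_clan x) - Q_root (Log_clan y))" for x y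
    using bounded_linear_Q_root
    by (simp add: norm_clan_def Q_clan_eq_inner norm_eq_sqrt_inner[symmetric] linear_simps)
  then show ?thesis
    unfolding g_clan_eq_metric nabla_clan_eq_nabla
    using clan.riemannian_distance_eq clan.riemannian_complete clan.is_levi_civita_nabla
      clan.flat_nabla clan.torsion_free_nabla by simp
qed

end
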